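(* Let $k\ge 79$ be an integer and let $b$ be a positive integer satisfying $\frac{k}{2b^2}-\frac{k}{3b^3}\ge 3\log k$. When $|z|=e^{-k/(2b)}$, we have $$\rho_{0,k+1}(z)=\frac{k^{3/2}}{b(2\pi)^{3/2}}\left(1+\frac{1}{12k}+\epsilon_b\right),\qquad\text{where } \epsilon_b<\frac{9}{k^2}.$$
   Context: For an integer $k\ge 2$, $\rho_{0,k}$ denotes the Bergman kernel function of the punctured unit disk $\mathbb D^*=\{z\in\mathbb C: 0<|z|<1\}$ with the Poincaré metric $\omega=\frac{i\,dz\wedge d\bar z}{|z|^2(\log\frac1{|z|^2})^2}$, i.e. of the Hilbert space $\mathcal H_{0,k}$ of holomorphic functions $f$ on $\mathbb D^*$ with $\int_{\mathbb D^*}|f|^2(\log\frac{1}{|z|^2})^k\,\omega<\infty$: $\rho_{0,k}=(\log\frac1{|z|^2})^k\sum_i|f_i|^2$ for an orthonormal basis $(f_i)$ of $\mathcal H_{0,k}$. Explicitly, $$\rho_{0,k}(z)=\frac{(\log \frac{1}{|z|^2})^k}{2\pi (k-2)!}\sum_{a=1}^{\infty}a^{k-1}|z|^{2a}.$$ *)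

theory Defs
  imports "HOL-Complex_Analysis.Complex_Analysis"
begin

definition punctured_disk :: "complex set" where
  "punctured_disk = {z. 0 < cmod z \<and> cmod z < 1}"

definition log_weight :: "complex \<Rightarrow> real" where
  "log_weight z = ln (1 / (cmod z)\<^sup>2)"

text \<open>The volume form \<open>\<omega> = i dz \<and> d\<bar>z / (|z|\<^sup>2 (log (1/|z|\<^sup>2))\<^sup>2)\<close>
  as a measure on the punctured disk. The factor 2 comes from \<open>i dz \<and> d\<bar>z = 2 dx \<and> dy\<close>.
  The space is restricted to the punctured disk so that measurability and integrability do not
  depend on the values that functions of type \<^typ>\<open>complex \<Rightarrow> complex\<close> take elsewhere.\<close>

definition poincare_measure :: "complex measure" where
  "poincare_measure =
     density (restrict_space lborel punctured_disk)
       (\<lambda>z. ennreal (2 / ((cmod z)\<^sup>2 * (log_weight z)\<^sup>2)))"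

definition bergman_space :: "nat \<Rightarrow> (complex \<Rightarrow> complex) set" where
  "bergman_space k =
     {f. f holomorphic_on punctured_disk \<and>
         integrable poincare_measure (\<lambda>z. (cmod (f z))\<^sup>2 * log_weight z ^ k)}"

definition bergman_inner ::
    "nat \<Rightarrow> (complex \<Rightarrow> complex) \<Rightarrow> (complex \<Rightarrow> complex) \<Rightarrow> complex" where
  "bergman_inner k f g =
     (LINT z|poincare_measure. f z * cnj (g z) * of_real (log_weight z ^ k))"

definition bergman_norm :: "nat \<Rightarrow> (complex \<Rightarrow> complex) \<Rightarrow> real" where
  "bergman_norm k f = sqrt (LINT z|poincare_measure. (cmod (f z))\<^sup>2 * log_weight z ^ k)"

text \<open>An orthonormal family whose linear span is dense. Two functions that agree on the punctured
  disk and differ elsewhere represent the same element of the Hilbert space; orthonormality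
  prevents both from being members of the same basis.\<close>

definition bergman_orthonormal_basis :: "nat \<Rightarrow> (complex \<Rightarrow> complex) set \<Rightarrow> bool" where
  "bergman_orthonormal_basis k F \<longleftrightarrow>
     F \<subseteq> bergman_space k \<and>
     (\<forall>f\<in>F. \<forall>g\<in>F. bergman_inner k f g = (if f = g then 1 else 0)) \<and>
     (\<forall>h\<in>bergman_space k. \<forall>e>0. \<exists>S c. finite S \<and> S \<subseteq> F \<and>
        bergman_norm k (\<lambda>z. h z - (\<Sum>f\<in>S. c f * f z)) < e)"

text \<open>The value does not depend on the orthonormal basis; one is chosen arbitrarily.\<close>

definition bergman_kernel_function :: "nat \<Rightarrow> complex \<Rightarrow> real" where
  "bergman_kernel_function k z =
     log_weight z ^ k *
     (\<Sum>\<^sub>\<infinity>f\<in>(SOME F. bergman_orthonormal_basis k F). (cmod (f z))\<^sup>2)"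

end

(*
  Averaging over rotations and Parseval's identity on circles give, for f = sum c_n z^n, the norm
  |f|^2 = sum |c_n|^2 N_n with N_n = 2 pi (k-2)! / n^(k-1) and N_0 infinite.  An element of the Bergman
  space is bounded near the puncture by the sub-mean value property, so it has such an expansion with
  c_0 = 0, the normalised monomials form an orthonormal basis, and the kernel on the diagonal is
  log(1/|z|^2)^k sum |z|^(2n) / N_n for every orthonormal basis.

  On the circle |z| = exp(-k/(2b)) the kernel is the asserted leading factor times
  R * sum_a ((a/b) exp(1 - a/b))^k with R = sqrt(2 pi) k^(k+1/2) exp(-k) / k!.  Stirling's lower bound
  gives R <= 1.  The term a = b is 1; by the hypothesis on b the terms a = b + 1 and a = b - 1 are at
  most k^(-3), and by concavity of ln the terms at distance j are at most k^(-3j).  Hence the sum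
  exceeds 1 by O(k^(-3)), less than 1/(12k) + 9/k^2.
*)
theory Submission
  imports Defs "HOL-Probability.Distributions" "HOL-Real_Asymp.Real_Asymp"
begin

section \<open>Rotation invariance of Lebesgue measure on the complex plane\<close>

text \<open>\<open>bergman_kernel_function\<close> sums over a basis picked by \<open>SOME\<close>,
  of which only orthonormality and density are known. So two things must be shown: that a basis
  exists, and that every basis, of whatever cardinality, gives the same sum at a point. Both rest on
  computing norms from power series coefficients. The sub-mean value inequality comes from the same
  source: it keeps only the zeroth term of Parseval's identity on a ball. Two devices take the place
  of polar coordinates. Rotation invariance with Tonelli turns a planar integral against a radial
  weight into an integral of circle means. Radial integrals are then computed by pushing area
  forward to t = log(1/|z|^2), where its density is pi exp(-t); this makes N_n a Gamma integral.
  These computations use nonnegative integrals, so that the infinite norm of a constant is a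
  legitimate value and excludes c_0. The conclusion bounds the error term from above only; this is
  why a one-sided Stirling estimate suffices.\<close>

lemma measurable_Complex [measurable]:
  "(\<lambda>p. Complex (fst p) (snd p)) \<in> borel_measurable (lborel \<Otimes>\<^sub>M lborel)"
proof -
  have "(\<lambda>p. complex_of_real (fst p) + \<i> * complex_of_real (snd p)) \<in> borel_measurable (lborel \<Otimes>\<^sub>M lborel)"
    by measurable
  then show ?thesis by (simp add: Complex_eq)
qed

text \<open>Lebesgue measure is determined by its values on boxes, and a complex box is a product of
  two intervals. This carries Tonelli's theorem for two real variables over to the plane.\<close>

lemma lborel_complex_eq:
  "(lborel :: complex measure) = distr (lborel \<Otimes>\<^sub>M lborel) borel (\<lambda>p. Complex (fst p) (snd p))"
proof (rule lborel_eqI)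
  fix l u :: complex
  assume lu: "\<And>b. b \<in> Basis \<Longrightarrow> l \<bullet> b \<le> u \<bullet> b"
  have "(\<lambda>p. Complex (fst p) (snd p)) -` box l u = {Re l<..<Re u} \<times> {Im l<..<Im u}"
    by (auto simp: in_box_complex_iff)
  moreover have "Re l \<le> Re u" "Im l \<le> Im u"
    using lu[of 1] lu[of \<i>] by (auto simp: Basis_complex_def)
  ultimately show "emeasure (distr (lborel \<Otimes>\<^sub>M lborel) borel (\<lambda>p. Complex (fst p) (snd p))) (box l u) =
      (\<Prod>b\<in>Basis. (u - l) \<bullet> b)"
    by (subst emeasure_distr)
       (auto simp: space_pair_measure lborel.emeasure_pair_measure_Times Basis_complex_def ennreal_mult)
qed simp

text \<open>Both orders of integration are recorded because a horizontal shear is a translation for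
  fixed y and a vertical shear a translation for fixed x.\<close>

lemma nn_integral_lborel_complex:
  assumes [measurable]: "f \<in> borel_measurable borel"
  shows "(\<integral>\<^sup>+z. f z \<partial>lborel) = (\<integral>\<^sup>+x. \<integral>\<^sup>+y. f (Complex x y) \<partial>lborel \<partial>lborel)"
    and "(\<integral>\<^sup>+z. f z \<partial>lborel) = (\<integral>\<^sup>+y. \<integral>\<^sup>+x. f (Complex x y) \<partial>lborel \<partial>lborel)"
proof -
  have "(\<integral>\<^sup>+z. f z \<partial>lborel) = (\<integral>\<^sup>+p. f (Complex (fst p) (snd p)) \<partial>(lborel \<Otimes>\<^sub>M lborel))"
    by (subst lborel_complex_eq, subst nn_integral_distr) auto
  moreover have *: "(\<lambda>p. f (Complex (fst p) (snd p))) \<in> borel_measurable (lborel \<Otimes>\<^sub>M lborel)"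
    by (rule measurable_compose[OF measurable_Complex]) simp
  ultimately show "(\<integral>\<^sup>+z. f z \<partial>lborel) = (\<integral>\<^sup>+x. \<integral>\<^sup>+y. f (Complex x y) \<partial>lborel \<partial>lborel)"
    "(\<integral>\<^sup>+z. f z \<partial>lborel) = (\<integral>\<^sup>+y. \<integral>\<^sup>+x. f (Complex x y) \<partial>lborel \<partial>lborel)"
    using lborel.nn_integral_fst[OF *] lborel_pair.nn_integral_snd[OF *] 
    by (auto simp: case_prod_beta')
qed

lemma nn_integral_shift_real:
  fixes f :: "real \<Rightarrow> ennreal"
  assumes "f \<in> borel_measurable borel"
  shows "(\<integral>\<^sup>+x. f (x + t) \<partial>lborel) = (\<integral>\<^sup>+x. f x \<partial>lborel)"
  using nn_integral_real_affine[OF assms, of 1 t] by (simp add: add.commute)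

lemma measurable_Complex_left [measurable]: "(\<lambda>x. Complex x y) \<in> borel_measurable borel"
  unfolding Complex_eq by measurable

lemma measurable_Complex_right [measurable]: "(\<lambda>y. Complex x y) \<in> borel_measurable borel"
  unfolding Complex_eq by measurable

text \<open>With one coordinate fixed, a shear translates the other one, so translation invariance
  on the real line is enough.\<close>

lemma nn_integral_shear:
  assumes [measurable]: "f \<in> borel_measurable borel"
  shows "(\<integral>\<^sup>+z. f (z + of_real (t * Im z)) \<partial>lborel) = (\<integral>\<^sup>+z. f z \<partial>lborel)"
    and "(\<integral>\<^sup>+z. f (z + \<i> * of_real (t * Re z)) \<partial>lborel) = (\<integral>\<^sup>+z. f z \<partial>lborel)"
proof -
  have e: "Complex x y + of_real (t * Im (Complex x y)) = Complex (x + t * y) y"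
    "Complex x y + \<i> * of_real (t * Re (Complex x y)) = Complex x (y + t * x)" for x y
    by (auto simp: complex_eq_iff)
  have "(\<integral>\<^sup>+z. f (z + of_real (t * Im z)) \<partial>lborel) =
      (\<integral>\<^sup>+y. \<integral>\<^sup>+x. f (Complex (x + t * y) y) \<partial>lborel \<partial>lborel)"
    by (subst nn_integral_lborel_complex(2)) (measurable, simp only: e)
  also have "\<dots> = (\<integral>\<^sup>+y. \<integral>\<^sup>+x. f (Complex x y) \<partial>lborel \<partial>lborel)"
    by (intro nn_integral_cong nn_integral_shift_real) measurable
  finally show "(\<integral>\<^sup>+z. f (z + of_real (t * Im z)) \<partial>lborel) = (\<integral>\<^sup>+z. f z \<partial>lborel)"
    by (simp add: nn_integral_lborel_complex(2)[of f])
  have "(\<integral>\<^sup>+z. f (z + \<i> * of_real (t * Re z)) \<partial>lborel) =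
      (\<integral>\<^sup>+x. \<integral>\<^sup>+y. f (Complex x (y + t * x)) \<partial>lborel \<partial>lborel)"
    by (subst nn_integral_lborel_complex(1)) (measurable, simp only: e)
  also have "\<dots> = (\<integral>\<^sup>+x. \<integral>\<^sup>+y. f (Complex x y) \<partial>lborel \<partial>lborel)"
    by (intro nn_integral_cong nn_integral_shift_real) measurable
  finally show "(\<integral>\<^sup>+z. f (z + \<i> * of_real (t * Re z)) \<partial>lborel) = (\<integral>\<^sup>+z. f z \<partial>lborel)"
    by (simp add: nn_integral_lborel_complex(1)[of f])
qed

text \<open>A rotation by an angle other than \<open>\<pi>\<close> is a product of three shears, and the rotation by \<open>\<pi>\<close>
  is the square of the rotation by \<open>\<pi>/2\<close>.\<close>

lemma nn_integral_rotate:
  fixes f :: "complex \<Rightarrow> ennreal"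
  assumes f [measurable]: "f \<in> borel_measurable borel" and c: "cmod c = 1"
  shows "(\<integral>\<^sup>+z. f (c * z) \<partial>lborel) = (\<integral>\<^sup>+z. f z \<partial>lborel)"
proof -
  have rot: "(\<integral>\<^sup>+z. f (c * z) \<partial>lborel) = (\<integral>\<^sup>+z. f z \<partial>lborel)"
    if [measurable]: "f \<in> borel_measurable borel" and c: "cmod c = 1" "Re c \<noteq> -1"
    for c and f :: "complex \<Rightarrow> ennreal"
  proof -
    define a b where "a = Re c" and "b = Im c"
    have ab: "a ^ 2 + b ^ 2 = 1" "1 + a \<noteq> 0"
      using c by (auto simp: a_def b_def cmod_def)
    \<comment> \<open>For c = cos phi + i sin phi this is -tan(phi/2). The rotation is the shear
      \<open>S1\<close> with parameter \<open>t\<close>, then \<open>S2\<close> with parameter sin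
      phi, then \<open>S1\<close> again.\<close>
    define t where "t = - b / (1 + a)"
    have "b * b = (1 - a) * (1 + a)" using ab by (simp add: algebra_simps power2_eq_square)
    then have bt: "1 + b * t = a" using ab(2) unfolding t_def by (simp add: field_simps)
    have ta: "t * (1 + a) = - b" using ab(2) unfolding t_def by simp
    define S1 where "S1 z = z + of_real (t * Im z)" for z
    define S2 where "S2 z = z + \<i> * of_real (b * Re z)" for z
    have [measurable]: "S1 \<in> borel_measurable borel" "S2 \<in> borel_measurable borel"
      unfolding S1_def S2_def by measurable
    have "c * z = S1 (S2 (S1 z))" for z
    proof (rule complex_eqI)
      have "Re (S1 (S2 (S1 z))) = (1 + b * t) * Re z + (t * (1 + (1 + b * t))) * Im z"
        by (simp add: S1_def S2_def algebra_simps)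
      also have "\<dots> = a * Re z - b * Im z" unfolding bt ta by simp
      finally show "Re (c * z) = Re (S1 (S2 (S1 z)))" by (simp add: a_def b_def)
      have "Im (S1 (S2 (S1 z))) = (1 + b * t) * Im z + b * Re z"
        by (simp add: S1_def S2_def algebra_simps)
      then show "Im (c * z) = Im (S1 (S2 (S1 z)))" unfolding bt by (simp add: a_def b_def)
    qed
    then have "(\<integral>\<^sup>+z. f (c * z) \<partial>lborel) = (\<integral>\<^sup>+z. f (S1 (S2 (S1 z))) \<partial>lborel)" by simp
    also have "\<dots> = (\<integral>\<^sup>+z. f (S1 (S2 z)) \<partial>lborel)"
      using nn_integral_shear(1)[of "\<lambda>z. f (S1 (S2 z))" t] unfolding S1_def[symmetric] by simp
    also have "\<dots> = (\<integral>\<^sup>+z. f (S1 z) \<partial>lborel)"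
      using nn_integral_shear(2)[of "\<lambda>z. f (S1 z)" b] unfolding S2_def[symmetric] by simp
    also have "\<dots> = (\<integral>\<^sup>+z. f z \<partial>lborel)"
      using nn_integral_shear(1)[of f t] unfolding S1_def[symmetric] by simp
    finally show ?thesis .
  qed
  show ?thesis
  proof (cases "Re c = -1")
    case True
    then have "c = \<i> * \<i>" using c by (auto simp: cmod_def complex_eq_iff)
    then show ?thesis
      using rot[of "\<lambda>z. f (\<i> * z)" \<i>] rot[of f \<i>] by (simp add: mult.assoc)
  qed (use rot[of f c] c in simp)
qed

lemma lborel_distr_rotate:
  assumes "cmod c = 1"
  shows "distr lborel borel (\<lambda>z. c * z) = (lborel :: complex measure)"
proof (rule measure_eqI)
  fix A assume "A \<in> sets (distr lborel borel (\<lambda>z. c * z))"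
  then have [measurable]: "A \<in> sets borel" by simp
  have "emeasure (distr lborel borel (\<lambda>z. c * z)) A = (\<integral>\<^sup>+z. indicator A (c * z) \<partial>lborel)"
    by (subst nn_integral_distr[of _ _ borel "indicator A", symmetric]) (auto simp: nn_integral_indicator)
  also have "\<dots> = emeasure lborel A" by (subst nn_integral_rotate) (use assms in auto)
  finally show "emeasure (distr lborel borel (\<lambda>z. c * z)) A = emeasure lborel A" .
qed simp

section \<open>The punctured disk in the coordinate t = log(1/|z|^2)\<close>

lemma emeasure_lborel_complex_ball:
  "r \<ge> 0 \<Longrightarrow> emeasure lborel (ball (c::complex) r) = ennreal (pi * r ^ 2)"
  by (simp add: emeasure_ball unit_ball_vol_2)

lemma open_punctured_disk: "open punctured_disk"
  unfolding punctured_disk_def by (intro open_Collect_conj open_Collect_less continuous_intros)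

lemma punctured_disk_borel [measurable]: "punctured_disk \<in> sets borel"
  using open_punctured_disk by simp

lemma log_weight_borel [measurable]: "log_weight \<in> borel_measurable borel"
  unfolding log_weight_def by measurable

lemma log_weight_pos: "z \<in> punctured_disk \<Longrightarrow> log_weight z > 0"
  by (auto simp: log_weight_def punctured_disk_def intro!: ln_gt_zero power_less_one_iff[THEN iffD2])

lemma exp_minus_log_weight: "z \<noteq> 0 \<Longrightarrow> exp (- log_weight z) = (cmod z)\<^sup>2"
  by (simp add: log_weight_def ln_div)

text \<open>The set where \<open>log_weight\<close> exceeds y >= 0 is the punctured disk of radius
  exp(-y/2), whose area is pi exp(-y). It suffices to compare both measures on half-lines.\<close>

lemma distr_log_weight:
  "distr (restrict_space lborel punctured_disk) borel log_weight =
     density lborel (\<lambda>t. ennreal (pi * exp (- t)) * indicator {0<..} t)"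
proof (rule measure_eqI_lessThan)
  have Lm: "log_weight \<in> measurable (restrict_space lborel punctured_disk) borel"
    by (rule measurable_restrict_space1) simp
  fix x :: real
  \<comment> \<open>Both measures live on t > 0, so a negative threshold has the same effect as
    0.\<close>
  define y where "y = max 0 x"
  have *: "log_weight z > y \<longleftrightarrow> cmod z < exp (- y / 2)" if "z \<noteq> 0" for z :: complex
  proof -
    have "log_weight z = - 2 * ln (cmod z)"
      using that by (simp add: log_weight_def ln_div ln_realpow)
    moreover have "cmod z < exp (- y / 2) \<longleftrightarrow> ln (cmod z) < - y / 2"
      using that by (subst ln_less_cancel_iff[symmetric]) auto
    ultimately show ?thesis by linarith
  qed
  have sub: "cmod z < 1" if "cmod z < exp (- y / 2)" for z :: complex
  proof -
    have "exp (- y / 2) \<le> 1" by (simp add: y_def)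
    then show ?thesis using that by linarith
  qed
  have "log_weight -` {x<..} \<inter> punctured_disk = ball 0 (exp (- y / 2)) - {0}"
  proof (intro set_eqI iffI)
    fix z assume z: "z \<in> log_weight -` {x<..} \<inter> punctured_disk"
    then have "log_weight z > y" "z \<noteq> 0" using log_weight_pos[of z] by (auto simp: y_def punctured_disk_def)
    then show "z \<in> ball 0 (exp (- y / 2)) - {0}" using * by auto
  next
    fix z :: complex assume z: "z \<in> ball 0 (exp (- y / 2)) - {0}"
    then have "log_weight z > y" using * by auto
    then show "z \<in> log_weight -` {x<..} \<inter> punctured_disk"
      using z sub[of z] by (auto simp: y_def punctured_disk_def)
  qed
  moreover from this have "ball 0 (exp (- y / 2)) - {0} \<subseteq> punctured_disk" by blast
  ultimately have "emeasure (distr (restrict_space lborel punctured_disk) borel log_weight) {x<..} =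
      emeasure lborel (ball (0::complex) (exp (- y / 2)) - {0})"
    using Lm by (subst emeasure_distr) (auto simp: emeasure_restrict_space space_restrict_space)
  also have "\<dots> = emeasure lborel (ball (0::complex) (exp (- y / 2)))"
    by (rule emeasure_Diff_null_set) (auto simp: null_sets_def)
  also have "\<dots> = ennreal (pi * exp (- y))"
    by (simp add: emeasure_lborel_complex_ball power2_eq_square exp_add[symmetric])
  finally have l: "emeasure (distr (restrict_space lborel punctured_disk) borel log_weight) {x<..} =
    ennreal (pi * exp (- y))" .
  have "emeasure (density lborel (\<lambda>t. ennreal (pi * exp (- t)) * indicator {0<..} t)) {x<..} =
     (\<integral>\<^sup>+t. ennreal (pi * exp (- t)) * indicator {0<..} t * indicator {x<..} t \<partial>lborel)"
    by (subst emeasure_density) auto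
  also have "\<dots> = (\<integral>\<^sup>+t. ennreal (pi * exp (- t)) * indicator {y..} t \<partial>lborel)"
    by (rule nn_integral_cong_AE, rule AE_mp[OF AE_lborel_singleton[of y]])
       (auto simp: y_def indicator_def)
  also have "\<dots> = ennreal (0 - (- pi * exp (- y)))"
  proof (rule nn_integral_FTC_atLeast)
    show "((\<lambda>t. - pi * exp (- t)) has_real_derivative pi * exp (- t)) (at t)" for t
      by (auto intro!: derivative_eq_intros)
    have "((\<lambda>t. - pi * exp (- t)) \<longlongrightarrow> - pi * 0) at_top"
      by (intro tendsto_intros filterlim_compose[OF exp_at_bot] filterlim_uminus_at_bot_at_top)
    then show "((\<lambda>t. - pi * exp (- t)) \<longlongrightarrow> 0) at_top" by simp
  qed auto
  finally show "emeasure (distr (restrict_space lborel punctured_disk) borel log_weight) {x<..} =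
     emeasure (density lborel (\<lambda>t. ennreal (pi * exp (- t)) * indicator {0<..} t)) {x<..}"
    using l by simp
  show "emeasure (distr (restrict_space lborel punctured_disk) borel log_weight) {x<..} < \<infinity>"
    unfolding l by simp
qed simp_all

section \<open>Parseval's identity for radial weights\<close>

lemma has_integral_cis_multiple:
  fixes j :: int
  shows "((\<lambda>\<theta>. cis (of_int j * \<theta>)) has_integral (if j = 0 then complex_of_real (2 * pi) else 0)) {0..2 * pi}"
proof (cases "j = 0")
  case True
  then show ?thesis using has_integral_const_real[of "1::complex" 0 "2 * pi"] by (simp add: scaleR_conv_of_real)
next
  case False
  have "((\<lambda>\<theta>. cis (of_int j * \<theta>)) has_integral
      (cis (of_int j * (2 * pi)) / (\<i> * of_int j) - cis (of_int j * 0) / (\<i> * of_int j))) {0..2 * pi}"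
  proof (rule fundamental_theorem_of_calculus)
    fix x :: real
    have "((\<lambda>w. exp (\<i> * of_int j * w) / (\<i> * of_int j)) has_field_derivative exp (\<i> * of_int j * of_real x))
        (at (complex_of_real x))"
      using False by (auto intro!: derivative_eq_intros)
    from has_vector_derivative_real_field[OF this]
    show "((\<lambda>\<theta>. cis (of_int j * \<theta>) / (\<i> * of_int j)) has_vector_derivative cis (of_int j * x))
        (at x within {0..2 * pi})"
      by (simp add: cis_conv_exp mult.assoc)
  qed simp
  moreover have "cis (of_int j * (2 * pi)) = 1"
    using cis_multiple_2pi[of "of_int j"] by (simp add: mult.commute)
  ultimately show ?thesis using False by simp
qed

lemma has_integral_trig_poly_norm_square:
  fixes a :: "nat \<Rightarrow> complex"
  shows "((\<lambda>\<theta>. (cmod (\<Sum>n<N. a n * cis \<theta> ^ n))\<^sup>2) has_integral 2 * pi * (\<Sum>n<N. (cmod (a n))\<^sup>2)) {0..2 * pi}"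
proof -
  have "((\<lambda>\<theta>. \<Sum>n<N. \<Sum>m<N. a n * cnj (a m) * cis (of_int (int n - int m) * \<theta>)) has_integral
      (\<Sum>n<N. \<Sum>m<N. a n * cnj (a m) * (if int n - int m = 0 then complex_of_real (2 * pi) else 0))) {0..2 * pi}"
    by (intro has_integral_sum has_integral_mult_right has_integral_cis_multiple) auto
  also have "(\<lambda>\<theta>. \<Sum>n<N. \<Sum>m<N. a n * cnj (a m) * cis (of_int (int n - int m) * \<theta>)) =
      (\<lambda>\<theta>. complex_of_real ((cmod (\<Sum>n<N. a n * cis \<theta> ^ n))\<^sup>2))"
  proof
    fix \<theta>
    have "a n * cnj (a m) * cis (of_int (int n - int m) * \<theta>) =
        (a n * cis \<theta> ^ n) * cnj (a m * cis \<theta> ^ m)" for n m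
    proof -
      have "cis (of_int (int n - int m) * \<theta>) = cis \<theta> ^ n * cnj (cis \<theta> ^ m)"
      proof -
        have "of_int (int n - int m) * \<theta> = real n * \<theta> + - (real m * \<theta>)" by (simp add: algebra_simps)
        then show ?thesis by (simp only: Complex.DeMoivre cis_mult[symmetric] cis_cnj[symmetric])
      qed
      then show ?thesis by simp
    qed
    then show "(\<Sum>n<N. \<Sum>m<N. a n * cnj (a m) * cis (of_int (int n - int m) * \<theta>)) =
        complex_of_real ((cmod (\<Sum>n<N. a n * cis \<theta> ^ n))\<^sup>2)"
      by (simp only: complex_norm_square cnj_sum sum_product)
  qed
  also have "(\<Sum>n<N. \<Sum>m<N. a n * cnj (a m) * (if int n - int m = 0 then complex_of_real (2 * pi) else 0)) =
      complex_of_real (2 * pi * (\<Sum>n<N. (cmod (a n))\<^sup>2))"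
  proof -
    have "(\<Sum>m<N. a n * cnj (a m) * (if int n - int m = 0 then complex_of_real (2 * pi) else 0)) =
        complex_of_real (2 * pi * (cmod (a n))\<^sup>2)" if "n < N" for n
    proof -
      have "(\<Sum>m<N. a n * cnj (a m) * (if int n - int m = 0 then complex_of_real (2 * pi) else 0)) =
          (\<Sum>m<N. if m = n then a n * cnj (a m) * complex_of_real (2 * pi) else 0)"
        by (intro sum.cong) auto
      then show ?thesis using that by (simp add: complex_norm_square[symmetric] mult.commute)
    qed
    then show ?thesis by (simp add: sum_distrib_left)
  qed
  finally have "((\<lambda>\<theta>. Re (complex_of_real ((cmod (\<Sum>n<N. a n * cis \<theta> ^ n))\<^sup>2))) has_integral
      Re (complex_of_real (2 * pi * (\<Sum>n<N. (cmod (a n))\<^sup>2)))) {0..2 * pi}"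
    by (rule has_integral_linear[OF _ bounded_linear_Re, unfolded o_def])
  then show ?thesis by simp
qed

lemma measurable_cis [measurable]: "cis \<in> borel_measurable borel"
  unfolding cis_conv_exp by measurable

text \<open>Limit of the finite identity by dominated convergence: absolute summability bounds all
  partial sums by one constant, which is integrable over a period.\<close>

lemma nn_integral_circle_norm_square:
  fixes a :: "nat \<Rightarrow> complex"
  assumes a: "summable (\<lambda>n. cmod (a n))"
  shows "(\<integral>\<^sup>+\<theta>. ennreal ((cmod (\<Sum>n. a n * cis \<theta> ^ n))\<^sup>2) * indicator {0..2 * pi} \<theta> \<partial>lborel) =
    ennreal (2 * pi) * (\<Sum>n. ennreal ((cmod (a n))\<^sup>2))"
proof (rule LIMSEQ_unique)
  let ?S = "\<lambda>N \<theta>. \<Sum>n<N. a n * cis \<theta> ^ n"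
  let ?B = "\<Sum>n. cmod (a n)"
  have norm_term: "cmod (a n * cis \<theta> ^ n) = cmod (a n)" for n \<theta>
    by (simp add: norm_mult norm_power)
  have sm: "summable (\<lambda>n. a n * cis \<theta> ^ n)" for \<theta>
    by (rule summable_norm_cancel) (simp only: norm_term a)
  have lim: "(\<lambda>N. ?S N \<theta>) \<longlonglongrightarrow> (\<Sum>n. a n * cis \<theta> ^ n)" for \<theta>
    using summable_LIMSEQ[OF sm] .
  have [measurable]: "(\<lambda>\<theta>. \<Sum>n. a n * cis \<theta> ^ n) \<in> borel_measurable borel"
    by (rule borel_measurable_LIMSEQ_metric[OF _ lim]) measurable
  show "(\<lambda>N. \<integral>\<^sup>+\<theta>. ennreal ((cmod (?S N \<theta>))\<^sup>2) * indicator {0..2 * pi} \<theta> \<partial>lborel) \<longlonglongrightarrow>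
      (\<integral>\<^sup>+\<theta>. ennreal ((cmod (\<Sum>n. a n * cis \<theta> ^ n))\<^sup>2) * indicator {0..2 * pi} \<theta> \<partial>lborel)"
  proof (rule nn_integral_dominated_convergence[where w = "\<lambda>\<theta>. ennreal (?B\<^sup>2) * indicator {0..2 * pi} \<theta>"])
    show "AE \<theta> in lborel. (\<lambda>N. ennreal ((cmod (?S N \<theta>))\<^sup>2) * indicator {0..2 * pi} \<theta>) \<longlonglongrightarrow>
        ennreal ((cmod (\<Sum>n. a n * cis \<theta> ^ n))\<^sup>2) * indicator {0..2 * pi} \<theta>"
      using lim by (intro AE_I2) (auto simp: indicator_def intro!: tendsto_intros)
    have "cmod (?S N \<theta>) \<le> ?B" for N \<theta>
    proof -
      have "cmod (?S N \<theta>) \<le> (\<Sum>n<N. cmod (a n))"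
        by (rule order_trans[OF norm_sum]) (simp only: norm_term)
      also have "\<dots> \<le> ?B" by (rule sum_le_suminf[OF a]) auto
      finally show ?thesis .
    qed
    then show "AE \<theta> in lborel. ennreal ((cmod (?S N \<theta>))\<^sup>2) * indicator {0..2 * pi} \<theta> \<le>
        ennreal (?B\<^sup>2) * indicator {0..2 * pi} \<theta>" for N
      by (intro AE_I2 mult_right_mono ennreal_leI power_mono) auto
    show "(\<integral>\<^sup>+\<theta>. ennreal (?B\<^sup>2) * indicator {0..2 * pi} \<theta> \<partial>lborel) < \<infinity>"
      by (simp add: nn_integral_cmult_indicator ennreal_mult_less_top)
  qed measurable
  have "(\<integral>\<^sup>+\<theta>. ennreal ((cmod (?S N \<theta>))\<^sup>2) * indicator {0..2 * pi} \<theta> \<partial>lborel) =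
      ennreal (2 * pi) * (\<Sum>n<N. ennreal ((cmod (a n))\<^sup>2))" for N
  proof -
    have "(\<integral>\<^sup>+\<theta>. ennreal ((cmod (?S N \<theta>))\<^sup>2) * indicator {0..2 * pi} \<theta> \<partial>lborel) =
        ennreal (2 * pi * (\<Sum>n<N. (cmod (a n))\<^sup>2))"
      using nn_integral_has_integral_lebesgue[OF _ has_integral_trig_poly_norm_square[of a N]]
      by (simp add: ennreal_mult' ennreal_indicator mult.commute)
    then show ?thesis by (simp add: ennreal_mult sum_nonneg)
  qed
  moreover have "(\<lambda>N. ennreal (2 * pi) * (\<Sum>n<N. ennreal ((cmod (a n))\<^sup>2))) \<longlonglongrightarrow>
      ennreal (2 * pi) * (\<Sum>n. ennreal ((cmod (a n))\<^sup>2))"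
    by (intro ennreal_tendsto_cmult summable_LIMSEQ) auto
  ultimately show "(\<lambda>N. \<integral>\<^sup>+\<theta>. ennreal ((cmod (?S N \<theta>))\<^sup>2) * indicator {0..2 * pi} \<theta> \<partial>lborel) \<longlonglongrightarrow>
      ennreal (2 * pi) * (\<Sum>n. ennreal ((cmod (a n))\<^sup>2))"
    by simp
qed

lemma borel_measurable_power_series_restrict:
  fixes c :: "nat \<Rightarrow> complex" and D :: "complex set"
  assumes "\<And>z. z \<in> D \<Longrightarrow> (\<lambda>n. c n * z ^ n) sums f z" and [measurable]: "D \<in> sets borel"
  shows "(\<lambda>z. f z * indicator D z) \<in> borel_measurable borel"
proof (rule borel_measurable_LIMSEQ_metric)
  show "(\<lambda>z. (\<Sum>n<N. c n * z ^ n) * indicator D z) \<in> borel_measurable borel" for N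
    by measurable
  show "(\<lambda>N. (\<Sum>n<N. c n * z ^ n) * indicator D z) \<longlonglongrightarrow> f z * indicator D z" for z
    using assms(1)[of z] by (cases "z \<in> D") (auto simp: sums_def)
qed

text \<open>Averaging the integrand over all rotations replaces \<open>|f|\<^sup>2\<close> by its mean over circles, which
  Parseval's identity evaluates.\<close>

lemma nn_integral_power_series_radial:
  fixes c :: "nat \<Rightarrow> complex" and w :: "real \<Rightarrow> ennreal"
  assumes sums: "\<And>z. 0 < cmod z \<Longrightarrow> cmod z < R \<Longrightarrow> (\<lambda>n. c n * z ^ n) sums f z"
    and [measurable]: "w \<in> borel_measurable borel"
    and w: "\<And>r. r \<notin> {0<..<R} \<Longrightarrow> w r = 0"
  shows "(\<integral>\<^sup>+z. ennreal ((cmod (f z))\<^sup>2) * w (cmod z) \<partial>lborel) =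
    (\<Sum>n. ennreal ((cmod (c n))\<^sup>2) * (\<integral>\<^sup>+z. ennreal (cmod z ^ (2 * n)) * w (cmod z) \<partial>(lborel :: complex measure)))"
proof -
  define D where "D = {z::complex. 0 < cmod z \<and> cmod z < R}"
  have [measurable]: "D \<in> sets borel" unfolding D_def by measurable
  \<comment> \<open>\<open>f\<close> is controlled only on \<open>D\<close>, where it is a limit of
    polynomials and hence measurable. Cutting it off there leaves the integrand unchanged, since
    \<open>w (cmod z)\<close> vanishes outside \<open>D\<close>.\<close>
  define F where "F z = f z * indicator D z" for z
  have [measurable]: "F \<in> borel_measurable borel"
    unfolding F_def by (rule borel_measurable_power_series_restrict) (auto simp: D_def intro!: sums)
  define g where "g z = ennreal ((cmod (F z))\<^sup>2) * w (cmod z)" for z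
  have [measurable]: "g \<in> borel_measurable borel" unfolding g_def by measurable
  have circle: "(\<integral>\<^sup>+\<theta>. g (cis \<theta> * z) * indicator {0..2 * pi} \<theta> \<partial>lborel) =
      ennreal (2 * pi) * (\<Sum>n. ennreal ((cmod (c n))\<^sup>2) * (ennreal (cmod z ^ (2 * n)) * w (cmod z)))" for z
  proof (cases "z \<in> D")
    case False
    then have "w (cmod z) = 0" using w by (auto simp: D_def)
    then show ?thesis by (simp add: g_def norm_mult)
  next
    case True
    \<comment> \<open>Convergence at a real point of larger modulus inside the domain upgrades
      convergence at \<open>z\<close> to absolute convergence.\<close>
    then obtain \<rho> where \<rho>: "cmod z < \<rho>" "\<rho> < R" using dense[of "cmod z" R] by (auto simp: D_def)
    then have "\<rho> > 0" by (smt (verit) norm_ge_zero)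
    with \<rho> have "summable (\<lambda>n. c n * complex_of_real \<rho> ^ n)"
      by (intro sums_summable[OF sums]) auto
    then have sm: "summable (\<lambda>n. cmod (c n * z ^ n))"
      by (rule powser_insidea) (use \<rho> \<open>\<rho> > 0\<close> in simp)
    have "g (cis \<theta> * z) = ennreal ((cmod (\<Sum>n. c n * z ^ n * cis \<theta> ^ n))\<^sup>2) * w (cmod z)" for \<theta>
    proof -
      have "cis \<theta> * z \<in> D" using True by (simp add: D_def norm_mult)
      then have "F (cis \<theta> * z) = (\<Sum>n. c n * (cis \<theta> * z) ^ n)"
        using sums[of "cis \<theta> * z"] by (simp add: F_def D_def sums_iff)
      then show ?thesis by (simp add: g_def norm_mult power_mult_distrib ac_simps)
    qed
    then have "(\<integral>\<^sup>+\<theta>. g (cis \<theta> * z) * indicator {0..2 * pi} \<theta> \<partial>lborel) =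
        (\<integral>\<^sup>+\<theta>. w (cmod z) * (ennreal ((cmod (\<Sum>n. c n * z ^ n * cis \<theta> ^ n))\<^sup>2) * indicator {0..2 * pi} \<theta>) \<partial>lborel)"
      by (simp add: ac_simps)
    also have "\<dots> = w (cmod z) * (ennreal (2 * pi) * (\<Sum>n. ennreal ((cmod (c n * z ^ n))\<^sup>2)))"
    proof (subst nn_integral_cmult)
      have "(\<lambda>\<theta>. \<Sum>n. c n * z ^ n * cis \<theta> ^ n) \<in> borel_measurable borel"
      proof (rule borel_measurable_LIMSEQ_metric)
        show "(\<lambda>N. \<Sum>n<N. c n * z ^ n * cis \<theta> ^ n) \<longlonglongrightarrow> (\<Sum>n. c n * z ^ n * cis \<theta> ^ n)" for \<theta>
          by (rule summable_LIMSEQ, rule summable_norm_cancel)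
             (use sm in \<open>simp add: norm_mult norm_power\<close>)
      qed measurable
      then show "(\<lambda>\<theta>. ennreal ((cmod (\<Sum>n. c n * z ^ n * cis \<theta> ^ n))\<^sup>2) * indicator {0..2 * pi} \<theta>)
          \<in> borel_measurable lborel"
        by measurable
    qed (simp only: nn_integral_circle_norm_square[OF sm])
    also have "\<dots> = ennreal (2 * pi) * (w (cmod z) * (\<Sum>n. ennreal ((cmod (c n * z ^ n))\<^sup>2)))"
      by (simp add: ac_simps)
    also have "w (cmod z) * (\<Sum>n. ennreal ((cmod (c n * z ^ n))\<^sup>2)) =
        (\<Sum>n. ennreal ((cmod (c n))\<^sup>2) * (ennreal (cmod z ^ (2 * n)) * w (cmod z)))"
      by (subst ennreal_suminf_cmult[symmetric])
         (simp add: norm_mult norm_power power_mult_distrib ennreal_mult power_mult[symmetric] ac_simps)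
    finally show ?thesis .
  qed
  \<comment> \<open>The planar integral is spread as a constant over all angles, rotated by each
    angle, and the order of integration exchanged; the inner integral is then the one in
    \<open>circle\<close>.\<close>
  have "ennreal (2 * pi) * (\<integral>\<^sup>+z. g z \<partial>lborel) =
      (\<integral>\<^sup>+\<theta>. (\<integral>\<^sup>+z. g z \<partial>lborel) * indicator {0..2 * pi} (\<theta>::real) \<partial>lborel)"
    by (simp add: nn_integral_cmult_indicator ac_simps)
  also have "\<dots> = (\<integral>\<^sup>+\<theta>. \<integral>\<^sup>+z. g (cis \<theta> * z) * indicator {0..2 * pi} \<theta> \<partial>lborel \<partial>lborel)"
    by (intro nn_integral_cong) (subst nn_integral_multc, measurable, simp add: nn_integral_rotate)
  also have "\<dots> = (\<integral>\<^sup>+z. \<integral>\<^sup>+\<theta>. g (cis \<theta> * z) * indicator {0..2 * pi} \<theta> \<partial>lborel \<partial>lborel)"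
    by (rule lborel_pair.Fubini'[symmetric]) measurable
  also have "\<dots> = (\<integral>\<^sup>+z. ennreal (2 * pi) *
      (\<Sum>n. ennreal ((cmod (c n))\<^sup>2) * (ennreal (cmod z ^ (2 * n)) * w (cmod z))) \<partial>lborel)"
    by (simp only: circle)
  also have "\<dots> = ennreal (2 * pi) * (\<Sum>n. ennreal ((cmod (c n))\<^sup>2) *
      (\<integral>\<^sup>+z. ennreal (cmod z ^ (2 * n)) * w (cmod z) \<partial>(lborel :: complex measure)))"
    by (subst nn_integral_cmult, measurable, subst nn_integral_suminf, measurable,
        subst nn_integral_cmult, measurable)
  finally have "(\<integral>\<^sup>+z. g z \<partial>lborel) = (\<Sum>n. ennreal ((cmod (c n))\<^sup>2) *
      (\<integral>\<^sup>+z. ennreal (cmod z ^ (2 * n)) * w (cmod z) \<partial>(lborel :: complex measure)))"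
    by (simp add: ennreal_mult_cancel_left)
  moreover have "g z = ennreal ((cmod (f z))\<^sup>2) * w (cmod z)" for z
    using w[of "cmod z"] by (cases "z \<in> D") (auto simp: g_def F_def D_def)
  ultimately show ?thesis by simp
qed

section \<open>Integration against the Poincare measure\<close>

lemma space_poincare_measure [simp]: "space poincare_measure = punctured_disk"
  by (simp add: poincare_measure_def space_restrict_space)

lemma sets_poincare_measure: "sets poincare_measure = sets (restrict_space borel punctured_disk)"
  by (simp add: poincare_measure_def sets_restrict_space)

lemma measurable_poincare_measure_iff:
  "f \<in> measurable poincare_measure N \<longleftrightarrow> f \<in> measurable (restrict_space lborel punctured_disk) N"
proof -
  have "sets poincare_measure = sets (restrict_space lborel punctured_disk)"
    unfolding sets_poincare_measure by (simp only: sets_restrict_space sets_lborel)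
  then have "measurable poincare_measure N = measurable (restrict_space lborel punctured_disk) N"
    by (rule measurable_cong_sets) (rule refl)
  then show ?thesis by (rule arg_cong)
qed

lemma borel_measurable_poincareI:
  "f \<in> borel_measurable borel \<Longrightarrow> f \<in> borel_measurable poincare_measure"
proof -
  assume "f \<in> borel_measurable borel"
  then have "f \<in> borel_measurable (restrict_space lborel punctured_disk)"
    by (intro measurable_restrict_space1) simp
  then show ?thesis by (rule measurable_poincare_measure_iff[THEN iffD2])
qed

lemma log_weight_poincare [measurable]: "log_weight \<in> borel_measurable poincare_measure"
  by (intro borel_measurable_poincareI) measurable

lemma holomorphic_measurable_poincare:
  assumes "f holomorphic_on punctured_disk"
  shows "f \<in> borel_measurable poincare_measure"
proof -
  have "f \<in> borel_measurable (restrict_space borel punctured_disk)"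
    by (intro borel_measurable_continuous_on_restrict holomorphic_on_imp_continuous_on assms)
  then show ?thesis
    by (subst measurable_cong_sets[OF sets_poincare_measure refl])
qed

lemma nn_integral_poincare:
  assumes "f \<in> borel_measurable poincare_measure"
  shows "(\<integral>\<^sup>+z. f z \<partial>poincare_measure) =
    (\<integral>\<^sup>+z. f z * (ennreal (2 / ((cmod z)\<^sup>2 * (log_weight z)\<^sup>2)) * indicator punctured_disk z) \<partial>lborel)"
proof -
  have "(\<integral>\<^sup>+z. f z \<partial>poincare_measure) =
      (\<integral>\<^sup>+z. ennreal (2 / ((cmod z)\<^sup>2 * (log_weight z)\<^sup>2)) * f z \<partial>restrict_space lborel punctured_disk)"
    unfolding poincare_measure_def
  proof (rule nn_integral_density)
    show "(\<lambda>z. ennreal (2 / ((cmod z)\<^sup>2 * (log_weight z)\<^sup>2))) \<in>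
        borel_measurable (restrict_space lborel punctured_disk)"
      by (rule measurable_restrict_space1) measurable
  qed (use assms measurable_poincare_measure_iff in blast)
  also have "\<dots> = (\<integral>\<^sup>+z. ennreal (2 / ((cmod z)\<^sup>2 * (log_weight z)\<^sup>2)) * f z *
      indicator punctured_disk z \<partial>lborel)"
    by (rule nn_integral_restrict_space) simp
  finally show ?thesis by (simp only: ac_simps)
qed

text \<open>Since |z|^2 = exp(-t), the factor 1/|z|^2 of the Poincare density cancels the exp(-t) in
  the push-forward of area. What remains is 2 pi dt / t^2.\<close>

lemma nn_integral_poincare_log_weight:
  assumes [measurable]: "h \<in> borel_measurable borel"
  shows "(\<integral>\<^sup>+z. h (log_weight z) \<partial>poincare_measure) =
    (\<integral>\<^sup>+t. h t * ennreal (2 * pi / t\<^sup>2) * indicator {0<..} t \<partial>lborel)"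
proof -
  let ?M = "restrict_space lborel punctured_disk"
  have [measurable]: "log_weight \<in> borel_measurable ?M"
    by (intro measurable_restrict_space1) simp
  have "(\<lambda>z. ennreal (2 / ((cmod z)\<^sup>2 * (log_weight z)\<^sup>2))) \<in> borel_measurable ?M"
    by (intro measurable_restrict_space1) simp
  then have "(\<integral>\<^sup>+z. h (log_weight z) \<partial>poincare_measure) =
      (\<integral>\<^sup>+z. ennreal (2 / ((cmod z)\<^sup>2 * (log_weight z)\<^sup>2)) * h (log_weight z) \<partial>?M)"
    unfolding poincare_measure_def by (intro nn_integral_density) auto
  also have "\<dots> = (\<integral>\<^sup>+z. ennreal (2 / (exp (- log_weight z) * (log_weight z)\<^sup>2)) * h (log_weight z) \<partial>?M)"
    by (intro nn_integral_cong) (auto simp: space_restrict_space punctured_disk_def exp_minus_log_weight)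
  also have "\<dots> = (\<integral>\<^sup>+t. ennreal (2 / (exp (- t) * t\<^sup>2)) * h t \<partial>(distr ?M borel log_weight))"
    by (subst nn_integral_distr) auto
  also have "\<dots> = (\<integral>\<^sup>+t. ennreal (pi * exp (- t)) * indicator {0<..} t *
      (ennreal (2 / (exp (- t) * t\<^sup>2)) * h t) \<partial>lborel)"
    unfolding distr_log_weight by (intro nn_integral_density) auto
  also have "\<dots> = (\<integral>\<^sup>+t. h t * ennreal (2 * pi / t\<^sup>2) * indicator {0<..} t \<partial>lborel)"
  proof (intro nn_integral_cong)
    fix t :: real
    have e: "ennreal (2 * pi / t\<^sup>2) = ennreal (pi * exp (- t)) * ennreal (2 / (exp (- t) * t\<^sup>2))"
      by (subst ennreal_mult[symmetric]) auto
    show "ennreal (pi * exp (- t)) * indicator {0<..} t * (ennreal (2 / (exp (- t) * t\<^sup>2)) * h t) =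
        h t * ennreal (2 * pi / t\<^sup>2) * indicator {0<..} t"
      unfolding e by (simp only: ac_simps)
  qed
  finally show ?thesis .
qed

text \<open>For \<open>n = 0\<close> and \<open>k \<ge> 2\<close> this is \<open>0\<close> and not the true value \<open>\<infinity>\<close>; since also \<open>1 / 0 = 0\<close>, the
  index \<open>0\<close> contributes nothing to the kernel series, as it should.\<close>

definition monomial_norm2 :: "nat \<Rightarrow> nat \<Rightarrow> real" where
  "monomial_norm2 k n = 2 * pi * fact (k - 2) / real n ^ (k - 1)"

lemma monomial_norm2_pos: "n > 0 \<Longrightarrow> monomial_norm2 k n > 0"
  by (simp add: monomial_norm2_def)

lemma nn_integral_power_exp:
  assumes "a > 0"
  shows "(\<integral>\<^sup>+t. ennreal (t ^ m * exp (- (a * t))) * indicator {0<..} t \<partial>lborel) = ennreal (fact m / a ^ (m + 1))"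
proof -
  have "ennreal (fact m) = (\<integral>\<^sup>+t. ennreal (t ^ m * exp (- t)) * indicator {0..} t \<partial>lborel)"
    using nn_intergal_power_times_exp_Ici[of m] by simp
  also have "\<dots> = ennreal \<bar>a\<bar> * (\<integral>\<^sup>+t. ennreal ((0 + a * t) ^ m * exp (- (0 + a * t))) * indicator {0..} (0 + a * t) \<partial>lborel)"
    using assms by (subst nn_integral_real_affine[where c = a and t = 0]) auto
  also have "(\<integral>\<^sup>+t. ennreal ((0 + a * t) ^ m * exp (- (0 + a * t))) * indicator {0..} (0 + a * t) \<partial>lborel) =
      (\<integral>\<^sup>+t. ennreal (a ^ m) * (ennreal (t ^ m * exp (- (a * t))) * indicator {0<..} t) \<partial>lborel)"
  proof (rule nn_integral_cong_AE, rule AE_mp[OF AE_lborel_singleton[of 0]], intro AE_I2 impI)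
    fix t :: real assume "t \<noteq> 0"
    then show "ennreal ((0 + a * t) ^ m * exp (- (0 + a * t))) * indicator {0..} (0 + a * t) =
        ennreal (a ^ m) * (ennreal (t ^ m * exp (- (a * t))) * indicator {0<..} t)"
      using assms by (cases "t > 0")
        (auto simp: power_mult_distrib ennreal_mult[symmetric] zero_le_mult_iff mult.assoc)
  qed
  also have "\<dots> = ennreal (a ^ m) * (\<integral>\<^sup>+t. ennreal (t ^ m * exp (- (a * t))) * indicator {0<..} t \<partial>lborel)"
    by (intro nn_integral_cmult) measurable
  finally have "ennreal (1 / a ^ (m + 1)) * ennreal (fact m) = ennreal (1 / a ^ (m + 1)) * (ennreal \<bar>a\<bar> *
      (ennreal (a ^ m) * (\<integral>\<^sup>+t. ennreal (t ^ m * exp (- (a * t))) * indicator {0<..} t \<partial>lborel)))"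
    by simp
  also have "\<dots> = ennreal (1 / a ^ (m + 1) * (a * a ^ m)) *
      (\<integral>\<^sup>+t. ennreal (t ^ m * exp (- (a * t))) * indicator {0<..} t \<partial>lborel)"
    using assms by (simp add: ennreal_mult[symmetric] mult.assoc[symmetric])
  also have "1 / a ^ (m + 1) * (a * a ^ m) = 1" using assms by simp
  finally show ?thesis using assms by (simp add: ennreal_mult[symmetric])
qed

text \<open>In the variable t the integrand becomes 2 pi t^(k-2) exp(-n t), a Gamma integral when n
  > 0.\<close>

lemma nn_integral_monomial:
  assumes k: "k \<ge> 2"
  shows "(\<integral>\<^sup>+z. ennreal (cmod z ^ (2 * n) * log_weight z ^ k) \<partial>poincare_measure) =
    (if n = 0 then \<infinity> else ennreal (monomial_norm2 k n))"
proof -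
  have "(\<integral>\<^sup>+z. ennreal (cmod z ^ (2 * n) * log_weight z ^ k) \<partial>poincare_measure) =
      (\<integral>\<^sup>+z. ennreal (exp (- log_weight z) ^ n * log_weight z ^ k) \<partial>poincare_measure)"
    by (intro nn_integral_cong) (auto simp: punctured_disk_def exp_minus_log_weight power_mult)
  also have "\<dots> = (\<integral>\<^sup>+t. ennreal (exp (- t) ^ n * t ^ k) * ennreal (2 * pi / t\<^sup>2) * indicator {0<..} t \<partial>lborel)"
    by (rule nn_integral_poincare_log_weight) measurable
  also have "\<dots> = (\<integral>\<^sup>+t. ennreal (2 * pi) * (ennreal (t ^ (k - 2) * exp (- (real n * t))) * indicator {0<..} t) \<partial>lborel)"
  proof (intro nn_integral_cong)
    fix t :: real
    have "t > 0 \<Longrightarrow> exp (- t) ^ n * t ^ k * (2 * pi / t\<^sup>2) = 2 * pi * (t ^ (k - 2) * exp (- (real n * t)))"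
      using k by (simp add: exp_of_nat_mult[symmetric] power_diff field_simps)
    then show "ennreal (exp (- t) ^ n * t ^ k) * ennreal (2 * pi / t\<^sup>2) * indicator {0<..} t =
        ennreal (2 * pi) * (ennreal (t ^ (k - 2) * exp (- (real n * t))) * indicator {0<..} t)"
      by (cases "t > 0") (auto simp: ennreal_mult[symmetric])
  qed
  also have "\<dots> = ennreal (2 * pi) * (\<integral>\<^sup>+t. ennreal (t ^ (k - 2) * exp (- (real n * t))) * indicator {0<..} t \<partial>lborel)"
    by (intro nn_integral_cmult) measurable
  finally have eq: "(\<integral>\<^sup>+z. ennreal (cmod z ^ (2 * n) * log_weight z ^ k) \<partial>poincare_measure) = \<dots>" .
  show ?thesis
  proof (cases "n = 0")
    \<comment> \<open>Without the exponential factor the integrand is at least 1 on t >= 1, a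
      half-line of infinite length.\<close>
    case True
    have "\<infinity> = (\<integral>\<^sup>+t. indicator {1..} (t::real) \<partial>lborel)" 
    proof (rule ccontr)
      assume "\<infinity> \<noteq> (\<integral>\<^sup>+t. indicator {1..} (t::real) \<partial>lborel)"
      then obtain r where r: "r \<ge> 0" "emeasure lborel {1::real..} = ennreal r"
        by (cases "emeasure lborel {1::real..}") auto
      have "emeasure lborel {1..r + 2} \<le> emeasure lborel {1::real..}" by (intro emeasure_mono) auto
      then show False using r by simp
    qed
    also have "\<dots> \<le> (\<integral>\<^sup>+t. ennreal (t ^ (k - 2) * exp (- (real n * t))) * indicator {0<..} t \<partial>lborel)"
      using True by (intro nn_integral_mono) (auto simp: indicator_def one_le_power)
    finally show ?thesis unfolding eq using True by (simp add: top_unique ennreal_mult_top)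
  next
    case False
    then show ?thesis unfolding eq using k
      by (subst nn_integral_power_exp)
         (auto simp: monomial_norm2_def ennreal_mult[symmetric] Suc_diff_Suc numeral_2_eq_2
           simp flip: power_Suc)
  qed
qed

lemma nn_integral_poincare_power_series:
  assumes k: "k \<ge> 2" and sums: "\<And>z. z \<in> punctured_disk \<Longrightarrow> (\<lambda>n. c n * z ^ n) sums f z"
  shows "(\<integral>\<^sup>+z. ennreal ((cmod (f z))\<^sup>2 * log_weight z ^ k) \<partial>poincare_measure) =
    (\<Sum>n. ennreal ((cmod (c n))\<^sup>2) * (if n = 0 then \<infinity> else ennreal (monomial_norm2 k n)))"
proof -
  \<comment> \<open>Poincare density and Hermitian weight together, as a function of the modulus
    that is cut off outside (0, 1).\<close>
  define w where "w r = ennreal (2 / (r\<^sup>2 * (ln (1 / r\<^sup>2))\<^sup>2)) * ennreal (ln (1 / r\<^sup>2) ^ k) * indicator {0<..<1} r"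
    for r :: real
  have [measurable]: "w \<in> borel_measurable borel" unfolding w_def by measurable
  have eq: "(\<integral>\<^sup>+z. ennreal ((cmod (g z))\<^sup>2 * log_weight z ^ k) \<partial>poincare_measure) =
      (\<integral>\<^sup>+z. ennreal ((cmod (g z))\<^sup>2) * w (cmod z) \<partial>lborel)"
    if [measurable]: "g \<in> borel_measurable poincare_measure" for g
  proof -
    have "(\<integral>\<^sup>+z. ennreal ((cmod (g z))\<^sup>2 * log_weight z ^ k) \<partial>poincare_measure) =
        (\<integral>\<^sup>+z. ennreal ((cmod (g z))\<^sup>2 * log_weight z ^ k) *
          (ennreal (2 / ((cmod z)\<^sup>2 * (log_weight z)\<^sup>2)) * indicator punctured_disk z) \<partial>lborel)"
      by (rule nn_integral_poincare) measurable
    also have "\<dots> = (\<integral>\<^sup>+z. ennreal ((cmod (g z))\<^sup>2) * w (cmod z) \<partial>lborel)"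
    proof (intro nn_integral_cong)
      fix z :: complex
      show "ennreal ((cmod (g z))\<^sup>2 * log_weight z ^ k) *
          (ennreal (2 / ((cmod z)\<^sup>2 * (log_weight z)\<^sup>2)) * indicator punctured_disk z) =
          ennreal ((cmod (g z))\<^sup>2) * w (cmod z)"
      proof (cases "z \<in> punctured_disk")
        case True
        then have "ennreal ((cmod (g z))\<^sup>2 * log_weight z ^ k) = ennreal ((cmod (g z))\<^sup>2) * ennreal (log_weight z ^ k)"
          using log_weight_pos[OF True] by (intro ennreal_mult) auto
        then show ?thesis using True
          by (simp add: w_def log_weight_def punctured_disk_def ac_simps)
      qed (auto simp: w_def punctured_disk_def indicator_def)
    qed
    finally show ?thesis .
  qed
  have "(\<lambda>z. f z * indicator punctured_disk z) \<in> borel_measurable borel"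
    by (rule borel_measurable_power_series_restrict[where c = c]) (auto intro: sums)
  then have "(\<lambda>z. f z * indicator punctured_disk z) \<in> borel_measurable poincare_measure"
    by (rule borel_measurable_poincareI)
  then have "f \<in> borel_measurable poincare_measure"
    by (rule measurable_cong[THEN iffD1, rotated]) auto
  from eq[OF this] have "(\<integral>\<^sup>+z. ennreal ((cmod (f z))\<^sup>2 * log_weight z ^ k) \<partial>poincare_measure) =
      (\<integral>\<^sup>+z. ennreal ((cmod (f z))\<^sup>2) * w (cmod z) \<partial>lborel)" .
  also have "\<dots> = (\<Sum>n. ennreal ((cmod (c n))\<^sup>2) *
      (\<integral>\<^sup>+z. ennreal (cmod z ^ (2 * n)) * w (cmod z) \<partial>(lborel :: complex measure)))"
    by (rule nn_integral_power_series_radial[where R = 1])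
       (auto simp: w_def punctured_disk_def indicator_def intro!: sums)
  also have "\<dots> = (\<Sum>n. ennreal ((cmod (c n))\<^sup>2) * (if n = 0 then \<infinity> else ennreal (monomial_norm2 k n)))"
  proof -
    \<comment> \<open>Applying \<open>eq\<close> backwards to z^n identifies the moments of
      \<open>w\<close> with the monomial integrals computed above.\<close>
    have "(\<integral>\<^sup>+z. ennreal (cmod z ^ (2 * n)) * w (cmod z) \<partial>(lborel :: complex measure)) =
        (if n = 0 then \<infinity> else ennreal (monomial_norm2 k n))" for n
      using eq[of "\<lambda>z. z ^ n"] nn_integral_monomial[OF k, of n]
      by (simp add: borel_measurable_poincareI norm_power power_mult[symmetric] mult.commute)
    then show ?thesis by simp
  qed
  finally show ?thesis .
qed

text \<open>Taylor expansion about \<open>z\<close> writes the integral over the ball as a sum of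
  nonnegative terms, and the term of index 0 is the area times |f(z)|^2.\<close>

lemma submean_value:
  assumes hol: "f holomorphic_on ball z s" and s: "s > 0"
  shows "ennreal (pi * s\<^sup>2 * (cmod (f z))\<^sup>2) \<le> (\<integral>\<^sup>+u. ennreal ((cmod (f u))\<^sup>2) * indicator (ball z s) u \<partial>lborel)"
proof -
  define c where "c n = (deriv ^^ n) f z / fact n" for n
  define g where "g u = f (z + u)" for u
  define w :: "real \<Rightarrow> ennreal" where "w = indicator {0<..<s}"
  have [measurable]: "w \<in> borel_measurable borel" unfolding w_def by measurable
  \<comment> \<open>\<open>w\<close> also omits the centre, as the radial Parseval lemma works on a
    punctured disk; a point does not affect the area.\<close>
  have area: "(\<integral>\<^sup>+u. w (cmod u) \<partial>(lborel :: complex measure)) = ennreal (pi * s\<^sup>2)"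
  proof -
    have "(\<integral>\<^sup>+u. w (cmod u) \<partial>(lborel :: complex measure)) = (\<integral>\<^sup>+u. indicator (ball 0 s) u \<partial>(lborel :: complex measure))"
      by (rule nn_integral_cong_AE, rule AE_mp[OF AE_lborel_singleton[of 0]])
         (auto simp: w_def indicator_def)
    then show ?thesis using s by (simp add: emeasure_lborel_complex_ball)
  qed
  have "ennreal (pi * s\<^sup>2 * (cmod (f z))\<^sup>2) =
      ennreal ((cmod (c 0))\<^sup>2) * (\<integral>\<^sup>+u. ennreal (cmod u ^ (2 * 0)) * w (cmod u) \<partial>(lborel :: complex measure))"
    using s by (simp add: area c_def ennreal_mult[symmetric] mult.commute)
  also have "\<dots> \<le> (\<Sum>n. ennreal ((cmod (c n))\<^sup>2) *
      (\<integral>\<^sup>+u. ennreal (cmod u ^ (2 * n)) * w (cmod u) \<partial>(lborel :: complex measure)))"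
    using sum_le_suminf[of "\<lambda>n. ennreal ((cmod (c n))\<^sup>2) *
      (\<integral>\<^sup>+u. ennreal (cmod u ^ (2 * n)) * w (cmod u) \<partial>(lborel :: complex measure))" "{0}"] by simp
  also have "\<dots> = (\<integral>\<^sup>+u. ennreal ((cmod (g u))\<^sup>2) * w (cmod u) \<partial>lborel)"
  proof (rule nn_integral_power_series_radial[symmetric, where R = s])
    show "(\<lambda>n. c n * u ^ n) sums g u" if "cmod u < s" for u
      using holomorphic_power_series[OF hol, of "z + u"] that
      by (simp add: c_def g_def dist_norm)
  qed (auto simp: w_def)
  also have "\<dots> \<le> (\<integral>\<^sup>+u. ennreal ((cmod (f (z + u)))\<^sup>2) * indicator (ball z s) (z + u) \<partial>lborel)"
    by (intro nn_integral_mono) (auto simp: w_def g_def indicator_def dist_norm)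
  also have "\<dots> = (\<integral>\<^sup>+u. ennreal ((cmod (f u))\<^sup>2) * indicator (ball z s) u \<partial>lborel)"
  proof -
    define F where "F u = f u * indicator (ball z s) u" for u
    have "(\<lambda>u. indicator (ball z s) u *\<^sub>R f u) \<in> borel_measurable borel"
      by (intro borel_measurable_continuous_on_indicator holomorphic_on_imp_continuous_on hol) simp
    moreover have "F = (\<lambda>u. indicator (ball z s) u *\<^sub>R f u)"
      by (auto simp: F_def indicator_def)
    ultimately have [measurable]: "F \<in> borel_measurable borel" by simp
    have F: "ennreal ((cmod (f u))\<^sup>2) * indicator (ball z s) u = ennreal ((cmod (F u))\<^sup>2)" for u
      by (simp add: F_def indicator_def)
    have "(\<integral>\<^sup>+u. ennreal ((cmod (F u))\<^sup>2) \<partial>lborel) = (\<integral>\<^sup>+u. ennreal ((cmod (F (z + u)))\<^sup>2) \<partial>lborel)"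
      by (subst lborel_distr_plus[of z, symmetric], subst nn_integral_distr) auto
    then show ?thesis by (simp only: F)
  qed
  finally show ?thesis .
qed

section \<open>The Bergman space of the punctured disk\<close>

lemma log_weight_power_nonneg: "z \<in> punctured_disk \<Longrightarrow> 0 \<le> log_weight z ^ k"
  using log_weight_pos[of z] by (simp add: less_imp_le)

lemma bergman_norm_nonneg: "bergman_norm k f \<ge> 0"
  unfolding bergman_norm_def
  by (auto intro!: integral_nonneg_AE AE_I2 mult_nonneg_nonneg log_weight_power_nonneg)

lemma bergman_norm_square:
  "(bergman_norm k f)\<^sup>2 = (LINT z|poincare_measure. (cmod (f z))\<^sup>2 * log_weight z ^ k)"
  unfolding bergman_norm_def
  by (auto intro!: integral_nonneg_AE AE_I2 mult_nonneg_nonneg log_weight_power_nonneg)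

lemma bergman_spaceD:
  assumes "f \<in> bergman_space k"
  shows "f holomorphic_on punctured_disk" "f \<in> borel_measurable poincare_measure"
    "integrable poincare_measure (\<lambda>z. (cmod (f z))\<^sup>2 * log_weight z ^ k)"
  using assms holomorphic_measurable_poincare[of f] by (auto simp: bergman_space_def)

lemma nn_integral_bergman_norm:
  assumes "f \<in> bergman_space k"
  shows "(\<integral>\<^sup>+z. ennreal ((cmod (f z))\<^sup>2 * log_weight z ^ k) \<partial>poincare_measure) = ennreal ((bergman_norm k f)\<^sup>2)"
  unfolding bergman_norm_square
  by (intro nn_integral_eq_integral bergman_spaceD(3)[OF assms] AE_I2)
     (auto intro!: mult_nonneg_nonneg log_weight_power_nonneg)

text \<open>The sub-mean value inequality is applied on the ball of radius |z|/2. There the weighted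
  Poincare density is at least a constant times 1/|z|^2, which balances the area pi |z|^2 / 4 of the
  ball, so the bound is uniform as z tends to 0.\<close>

lemma bergman_bounded_near_0:
  assumes k: "k \<ge> 2" and h: "h \<in> bergman_space k" and z: "z \<noteq> 0" "cmod z < 1 / 4"
  shows "(cmod (h z))\<^sup>2 \<le> 9 / (2 * pi) * (bergman_norm k h)\<^sup>2"
proof -
  define s where "s = cmod z / 2"
  have s: "s > 0" using z by (simp add: s_def)
  have ball: "cmod u \<le> 3 / 2 * cmod z \<and> u \<in> punctured_disk" if "u \<in> ball z s" for u
  proof -
    have "cmod u \<le> cmod z + cmod (z - u)" "cmod z \<le> cmod u + cmod (z - u)"
      using norm_triangle_sub[of u z] norm_triangle_sub[of z u] by (auto simp: norm_minus_commute)
    moreover have "cmod (z - u) < cmod z / 2" using that by (simp add: s_def dist_norm)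
    ultimately show ?thesis using z by (auto simp: punctured_disk_def)
  qed
  let ?I = "\<lambda>u. ennreal ((cmod (h u))\<^sup>2 * log_weight u ^ k)"
  let ?W = "\<lambda>u. ennreal (2 / ((cmod u)\<^sup>2 * (log_weight u)\<^sup>2)) * indicator punctured_disk u"
  have [measurable]: "h \<in> borel_measurable poincare_measure" by (rule bergman_spaceD[OF h])
  have "ennreal (pi * s\<^sup>2 * (cmod (h z))\<^sup>2) \<le> (\<integral>\<^sup>+u. ennreal ((cmod (h u))\<^sup>2) * indicator (ball z s) u \<partial>lborel)"
    by (intro submean_value holomorphic_on_subset[OF bergman_spaceD(1)[OF h]] s) (use ball in auto)
  also have "\<dots> \<le> (\<integral>\<^sup>+u. ennreal (9 / 8 * (cmod z)\<^sup>2) * ?I u * ?W u \<partial>lborel)"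
  proof (intro nn_integral_mono)
    fix u
    show "ennreal ((cmod (h u))\<^sup>2) * indicator (ball z s) u \<le> ennreal (9 / 8 * (cmod z)\<^sup>2) * ?I u * ?W u"
    proof (cases "u \<in> ball z s")
      case True
      from ball[OF this] have u: "cmod u \<le> 3 / 2 * cmod z" "u \<in> punctured_disk" "u \<noteq> 0"
        by (auto simp: punctured_disk_def)
      define L where "L = log_weight u"
      have "exp (- L) = (cmod u)\<^sup>2" unfolding L_def using u by (simp add: exp_minus_log_weight)
      also have "\<dots> \<le> (3 / 8)\<^sup>2" using u z by (intro power_mono) auto
      \<comment> \<open>(3/8)^2 = 9/64 is below 1/3, and exp(1) <= 3. This is where |z| < 1/4
        enters: it makes |u| at most 3/8 and thus L >= 1.\<close>
      also have "\<dots> \<le> exp (- 1)"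
        using exp_le by (simp add: exp_minus field_simps power2_eq_square)
      finally have L: "L \<ge> 1" by simp
      have "(cmod u)\<^sup>2 \<le> (3 / 2 * cmod z)\<^sup>2" using u by (intro power_mono) auto
      then have uz: "4 * (cmod u)\<^sup>2 \<le> 9 * (cmod z)\<^sup>2" by (simp add: power2_eq_square)
      \<comment> \<open>From |u| <= (3/2) |z| and L^2 <= L^k, the weighted density 2 L^k / (|u|^2
        L^2) is at least 8 / (9 |z|^2). Hence the factor 9/8 |z|^2, and after division by the area
        of the ball the constant 9/(2 pi).\<close>
      have "(cmod u)\<^sup>2 * L\<^sup>2 * 4 \<le> 9 * (cmod z)\<^sup>2 * L ^ k"
      proof -
        have "4 * (cmod u)\<^sup>2 * L\<^sup>2 \<le> 9 * (cmod z)\<^sup>2 * L ^ k"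
          by (intro mult_mono uz power_increasing k L) auto
        then show ?thesis by (simp add: ac_simps)
      qed
      then have "1 \<le> 9 / 8 * (cmod z)\<^sup>2 * L ^ k * (2 / ((cmod u)\<^sup>2 * L\<^sup>2))"
        using u(3) L by (simp add: field_simps)
      then have "(cmod (h u))\<^sup>2 * 1 \<le> (cmod (h u))\<^sup>2 * (9 / 8 * (cmod z)\<^sup>2 * L ^ k * (2 / ((cmod u)\<^sup>2 * L\<^sup>2)))"
        by (intro mult_left_mono) auto
      then have "ennreal ((cmod (h u))\<^sup>2) \<le>
          ennreal (9 / 8 * (cmod z)\<^sup>2 * ((cmod (h u))\<^sup>2 * L ^ k) * (2 / ((cmod u)\<^sup>2 * L\<^sup>2)))"
        by (intro ennreal_leI) (simp add: ac_simps)
      also have "\<dots> = ennreal (9 / 8 * (cmod z)\<^sup>2) * ?I u * ?W u"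
        using u L unfolding L_def[symmetric] by (subst ennreal_mult, simp, simp)+ simp
      finally show ?thesis using True by simp
    qed simp
  qed
  also have "\<dots> = (\<integral>\<^sup>+u. ennreal (9 / 8 * (cmod z)\<^sup>2) * ?I u \<partial>poincare_measure)"
    by (rule nn_integral_poincare[symmetric]) measurable
  also have "\<dots> = ennreal (9 / 8 * (cmod z)\<^sup>2) * ennreal ((bergman_norm k h)\<^sup>2)"
    by (subst nn_integral_cmult) (auto simp: nn_integral_bergman_norm[OF h])
  also have "\<dots> = ennreal (9 / 8 * (cmod z)\<^sup>2 * (bergman_norm k h)\<^sup>2)"
    by (rule ennreal_mult[symmetric]) auto
  finally have "pi * s\<^sup>2 * (cmod (h z))\<^sup>2 \<le> 9 / 8 * (cmod z)\<^sup>2 * (bergman_norm k h)\<^sup>2"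
    by (subst (asm) ennreal_le_iff) auto
  then show ?thesis using z by (simp add: s_def power2_eq_square field_simps)
qed

lemma bergman_expansion:
  assumes k: "k \<ge> 2" and h: "h \<in> bergman_space k"
  obtains c where "c 0 = 0" and "\<And>z. z \<in> punctured_disk \<Longrightarrow> (\<lambda>n. c n * z ^ n) sums h z"
proof -
  have D: "punctured_disk = ball 0 1 - {0}" by (auto simp: punctured_disk_def)
  have "cmod (h z) \<le> sqrt (9 / (2 * pi) * (bergman_norm k h)\<^sup>2)" if "z \<noteq> 0" "cmod z < 1 / 4" for z
    using bergman_bounded_near_0[OF k h that] by (rule real_le_rsqrt)
  then have "\<exists>B. eventually (\<lambda>z. norm (h z) \<le> B) (at 0)"
    unfolding eventually_at by (intro exI[of _ "sqrt (9 / (2 * pi) * (bergman_norm k h)\<^sup>2)"] exI[of _ "1 / 4"]) auto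
  moreover have "h holomorphic_on ball 0 1 - {0}" using bergman_spaceD(1)[OF h] D by simp
  ultimately obtain g where g: "g holomorphic_on ball 0 1" "\<And>z. z \<in> ball 0 1 - {0} \<Longrightarrow> g z = h z"
    using holomorphic_on_extend_bounded[of h "ball 0 1" 0] by auto
  define c where "c n = (deriv ^^ n) g 0 / fact n" for n
  have sums: "(\<lambda>n. c n * z ^ n) sums h z" if "z \<in> punctured_disk" for z
    using holomorphic_power_series[OF g(1), of z] that g(2)[of z] by (simp add: D c_def)
  \<comment> \<open>A nonzero constant coefficient would contribute an infinite term to the Parseval
    sum, which equals the finite squared norm.\<close>
  have "c 0 = 0"
  proof (rule ccontr)
    assume "c 0 \<noteq> 0"
    let ?t = "\<lambda>n. ennreal ((cmod (c n))\<^sup>2) * (if n = 0 then \<infinity> else ennreal (monomial_norm2 k n))"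
    have "\<infinity> = ?t 0" using \<open>c 0 \<noteq> 0\<close> by (simp add: ennreal_mult_top)
    also have "\<dots> \<le> (\<Sum>n. ?t n)" using sum_le_suminf[of ?t "{0}"] by simp
    also have "\<dots> = ennreal ((bergman_norm k h)\<^sup>2)"
      using nn_integral_poincare_power_series[OF k sums] nn_integral_bergman_norm[OF h] by simp
    finally show False by (simp add: top_unique)
  qed
  with sums that show thesis by blast
qed

lemma monomial_norm2_nonneg: "monomial_norm2 k n \<ge> 0"
  by (simp add: monomial_norm2_def)

text \<open>The infinite weight at index 0 meets the coefficient 0, and 0 times infinity is 0 in
  \<open>ennreal\<close>. It may therefore be replaced by the finite default value of
  \<open>monomial_norm2\<close>.\<close>

lemma nn_integral_power_series_real:
  assumes k: "k \<ge> 2" and sums: "\<And>z. z \<in> punctured_disk \<Longrightarrow> (\<lambda>n. c n * z ^ n) sums f z" and c: "c 0 = 0"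
  shows "(\<integral>\<^sup>+z. ennreal ((cmod (f z))\<^sup>2 * log_weight z ^ k) \<partial>poincare_measure) =
    (\<Sum>n. ennreal ((cmod (c n))\<^sup>2 * monomial_norm2 k n))"
proof -
  have "(\<integral>\<^sup>+z. ennreal ((cmod (f z))\<^sup>2 * log_weight z ^ k) \<partial>poincare_measure) =
      (\<Sum>n. ennreal ((cmod (c n))\<^sup>2) * (if n = 0 then \<infinity> else ennreal (monomial_norm2 k n)))"
    by (rule nn_integral_poincare_power_series[OF k sums])
  also have "\<dots> = (\<Sum>n. ennreal ((cmod (c n))\<^sup>2 * monomial_norm2 k n))"
    by (intro suminf_cong) (use c monomial_norm2_nonneg[of k] in \<open>auto simp: ennreal_mult\<close>)
  finally show ?thesis .
qed

lemma bergman_norm_sums: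
  assumes k: "k \<ge> 2" and h: "h \<in> bergman_space k" and c: "c 0 = 0"
    and sums: "\<And>z. z \<in> punctured_disk \<Longrightarrow> (\<lambda>n. c n * z ^ n) sums h z"
  shows "(\<lambda>n. (cmod (c n))\<^sup>2 * monomial_norm2 k n) sums (bergman_norm k h)\<^sup>2"
proof -
  let ?t = "\<lambda>n. (cmod (c n))\<^sup>2 * monomial_norm2 k n"
  have nonneg: "?t n \<ge> 0" for n by (simp add: monomial_norm2_nonneg)
  have eq: "(\<Sum>n. ennreal (?t n)) = ennreal ((bergman_norm k h)\<^sup>2)"
    using nn_integral_power_series_real[OF k sums c] nn_integral_bergman_norm[OF h] by simp
  then have sm: "summable ?t" by (intro summable_suminf_not_top nonneg) simp
  then have "ennreal (\<Sum>n. ?t n) = ennreal ((bergman_norm k h)\<^sup>2)"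
    using suminf_ennreal2[OF nonneg sm] eq by simp
  then have "(\<Sum>n. ?t n) = (bergman_norm k h)\<^sup>2"
    by (subst (asm) ennreal_inj) (auto intro: suminf_nonneg[OF sm nonneg])
  then show ?thesis using sm by (simp add: sums_iff)
qed

lemma monomial_in_bergman_space:
  assumes k: "k \<ge> 2" and n: "n > 0"
  shows "(\<lambda>z. a * z ^ n) \<in> bergman_space k"
proof -
  let ?c = "\<lambda>m. if m = n then a else 0"
  have "(\<lambda>m. ?c m * z ^ m) sums (a * z ^ n)" for z
    using sums_single[of n "\<lambda>m. a * z ^ m"] by (simp add: if_distrib[of "\<lambda>x. x * _"] cong: if_cong)
  then have eq: "(\<integral>\<^sup>+z. ennreal ((cmod (a * z ^ n))\<^sup>2 * log_weight z ^ k) \<partial>poincare_measure) =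
      (\<Sum>m. ennreal ((cmod (?c m))\<^sup>2 * monomial_norm2 k m))"
    using n by (intro nn_integral_power_series_real k) auto
  have "(\<lambda>m. ennreal ((cmod (?c m))\<^sup>2 * monomial_norm2 k m)) sums ennreal ((cmod a)\<^sup>2 * monomial_norm2 k n)"
    using sums_single[of n "\<lambda>m. ennreal ((cmod a)\<^sup>2 * monomial_norm2 k m)"] 
    by (rule sums_cong[THEN iffD1, rotated]) auto
  then have fin: "(\<integral>\<^sup>+z. ennreal ((cmod (a * z ^ n))\<^sup>2 * log_weight z ^ k) \<partial>poincare_measure) < \<infinity>"
    unfolding eq by (simp add: sums_iff)
  have hol: "(\<lambda>z. a * z ^ n) holomorphic_on punctured_disk" by (intro holomorphic_intros)
  have [measurable]: "(\<lambda>z. a * z ^ n) \<in> borel_measurable poincare_measure"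
    by (rule holomorphic_measurable_poincare[OF hol])
  have "integrable poincare_measure (\<lambda>z. (cmod (a * z ^ n))\<^sup>2 * log_weight z ^ k)"
    by (rule integrableI_nonneg[OF _ _ fin])
       (measurable, auto intro!: AE_I2 mult_nonneg_nonneg log_weight_power_nonneg)
  then show ?thesis using hol by (simp add: bergman_space_def)
qed

section \<open>Linear structure and inner product\<close>

lemma bergman_space_cmult:
  assumes "f \<in> bergman_space k"
  shows "(\<lambda>z. a * f z) \<in> bergman_space k"
proof -
  have "integrable poincare_measure (\<lambda>z. (cmod a)\<^sup>2 * ((cmod (f z))\<^sup>2 * log_weight z ^ k))"
    by (intro integrable_mult_right bergman_spaceD(3) assms)
  then show ?thesis using bergman_spaceD(1)[OF assms]
    by (auto simp: bergman_space_def norm_mult power_mult_distrib mult.assoc intro!: holomorphic_intros)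
qed

lemma bergman_space_add:
  assumes f: "f \<in> bergman_space k" and g: "g \<in> bergman_space k"
  shows "(\<lambda>z. f z + g z) \<in> bergman_space k"
proof -
  note [measurable] = bergman_spaceD(2)[OF f] bergman_spaceD(2)[OF g]
  have "integrable poincare_measure (\<lambda>z. (cmod (f z + g z))\<^sup>2 * log_weight z ^ k)"
  proof (rule Bochner_Integration.integrable_bound)
    show "integrable poincare_measure (\<lambda>z. 2 * ((cmod (f z))\<^sup>2 * log_weight z ^ k) + 2 * ((cmod (g z))\<^sup>2 * log_weight z ^ k))"
      by (intro Bochner_Integration.integrable_add integrable_mult_right bergman_spaceD(3) f g)
    show "AE z in poincare_measure. norm ((cmod (f z + g z))\<^sup>2 * log_weight z ^ k) \<le>
        norm (2 * ((cmod (f z))\<^sup>2 * log_weight z ^ k) + 2 * ((cmod (g z))\<^sup>2 * log_weight z ^ k))"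
    proof (rule AE_I2)
      fix z assume "z \<in> space poincare_measure"
      then have L: "0 \<le> log_weight z ^ k" by (simp add: log_weight_power_nonneg)
      have "(cmod (f z + g z))\<^sup>2 \<le> (cmod (f z) + cmod (g z))\<^sup>2"
        by (intro power_mono norm_triangle_ineq) auto
      also have "\<dots> \<le> 2 * (cmod (f z))\<^sup>2 + 2 * (cmod (g z))\<^sup>2"
        using sum_squares_bound[of "cmod (f z)" "cmod (g z)"] by (simp add: power2_sum)
      finally have "(cmod (f z + g z))\<^sup>2 * log_weight z ^ k \<le> (2 * (cmod (f z))\<^sup>2 + 2 * (cmod (g z))\<^sup>2) * log_weight z ^ k"
        by (rule mult_right_mono[OF _ L])
      moreover have "0 \<le> (cmod (f z + g z))\<^sup>2 * log_weight z ^ k" using L by simp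
      ultimately show "norm ((cmod (f z + g z))\<^sup>2 * log_weight z ^ k) \<le>
        norm (2 * ((cmod (f z))\<^sup>2 * log_weight z ^ k) + 2 * ((cmod (g z))\<^sup>2 * log_weight z ^ k))"
        by (simp add: algebra_simps)
    qed
  qed measurable
  then show ?thesis using bergman_spaceD(1)[OF f] bergman_spaceD(1)[OF g]
    by (auto simp: bergman_space_def intro!: holomorphic_intros)
qed

lemma bergman_space_sum:
  assumes "finite S" "S \<subseteq> bergman_space k"
  shows "(\<lambda>z. \<Sum>f\<in>S. a f * f z) \<in> bergman_space k"
  using assms
proof (induction S rule: finite_induct)
  case empty
  then show ?case by (simp add: bergman_space_def)
next
  case (insert f S)
  then show ?case by (simp add: bergman_space_add bergman_space_cmult)
qed

lemma bergman_space_diff: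
  assumes "f \<in> bergman_space k" and "g \<in> bergman_space k"
  shows "(\<lambda>z. f z - g z) \<in> bergman_space k"
  using bergman_space_add[OF assms(1) bergman_space_cmult[OF assms(2), of "-1"]] by simp

lemma bergman_inner_integrable:
  assumes f: "f \<in> bergman_space k" and g: "g \<in> bergman_space k"
  shows "integrable poincare_measure (\<lambda>z. f z * cnj (g z) * of_real (log_weight z ^ k))"
proof (rule Bochner_Integration.integrable_bound)
  note [measurable] = bergman_spaceD(2)[OF f] bergman_spaceD(2)[OF g]
  show "integrable poincare_measure (\<lambda>z. (cmod (f z))\<^sup>2 * log_weight z ^ k + (cmod (g z))\<^sup>2 * log_weight z ^ k)"
    by (intro Bochner_Integration.integrable_add bergman_spaceD(3) f g)
  have [measurable]: "(\<lambda>z. cnj (g z)) \<in> borel_measurable poincare_measure"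
    by (rule borel_measurable_continuous_on[OF _ bergman_spaceD(2)[OF g]]) (intro continuous_intros)
  show "(\<lambda>z. f z * cnj (g z) * of_real (log_weight z ^ k)) \<in> borel_measurable poincare_measure"
    by measurable
  show "AE z in poincare_measure. norm (f z * cnj (g z) * of_real (log_weight z ^ k)) \<le>
      norm ((cmod (f z))\<^sup>2 * log_weight z ^ k + (cmod (g z))\<^sup>2 * log_weight z ^ k)"
  proof (rule AE_I2)
    fix z assume "z \<in> space poincare_measure"
    then have L: "0 \<le> log_weight z ^ k" by (simp add: log_weight_power_nonneg)
    have "cmod (f z) * cmod (g z) \<le> (cmod (f z))\<^sup>2 + (cmod (g z))\<^sup>2"
    proof -
      have "0 \<le> cmod (f z) * cmod (g z)" by simp
      then show ?thesis using sum_squares_bound[of "cmod (f z)" "cmod (g z)"] by linarith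
    qed
    then have "cmod (f z) * cmod (g z) * log_weight z ^ k \<le> ((cmod (f z))\<^sup>2 + (cmod (g z))\<^sup>2) * log_weight z ^ k"
      by (rule mult_right_mono[OF _ L])
    then show "norm (f z * cnj (g z) * of_real (log_weight z ^ k)) \<le>
      norm ((cmod (f z))\<^sup>2 * log_weight z ^ k + (cmod (g z))\<^sup>2 * log_weight z ^ k)"
      using L by (simp add: norm_mult distrib_right del: of_real_power)
  qed
qed

lemma bergman_inner_self: "bergman_inner k f f = of_real ((bergman_norm k f)\<^sup>2)"
  unfolding bergman_norm_square bergman_inner_def integral_complex_of_real[symmetric]
  by (simp only: of_real_mult complex_norm_square)

lemma bergman_norm_sum:
  assumes S: "finite S" "S \<subseteq> bergman_space k"
    and orth: "\<And>f g. f \<in> S \<Longrightarrow> g \<in> S \<Longrightarrow> bergman_inner k f g = (if f = g then 1 else 0)"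
  shows "(bergman_norm k (\<lambda>z. \<Sum>f\<in>S. a f * f z))\<^sup>2 = (\<Sum>f\<in>S. (cmod (a f))\<^sup>2)"
proof -
  let ?p = "\<lambda>z. \<Sum>f\<in>S. a f * f z"
  have int: "integrable poincare_measure (\<lambda>z. a f * cnj (a g) * (f z * cnj (g z) * of_real (log_weight z ^ k)))"
    if "f \<in> S" "g \<in> S" for f g
    using that S by (intro integrable_mult_right bergman_inner_integrable) auto
  have "of_real ((bergman_norm k ?p)\<^sup>2) = (LINT z|poincare_measure.
      (\<Sum>f\<in>S. \<Sum>g\<in>S. a f * cnj (a g) * (f z * cnj (g z) * of_real (log_weight z ^ k))))"
    unfolding bergman_inner_self[symmetric] bergman_inner_def cnj_sum sum_product
    unfolding sum_distrib_right by (simp only: complex_cnj_mult ac_simps)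
  also have "\<dots> = (\<Sum>f\<in>S. \<Sum>g\<in>S. a f * cnj (a g) * bergman_inner k f g)"
    unfolding bergman_inner_def using int
    by (simp add: Bochner_Integration.integral_sum Bochner_Integration.integrable_sum del: of_real_power)
  also have "\<dots> = (\<Sum>f\<in>S. \<Sum>g\<in>S. if g = f then a f * cnj (a g) else 0)"
    by (intro sum.cong refl) (auto simp: orth)
  also have "\<dots> = of_real (\<Sum>f\<in>S. (cmod (a f))\<^sup>2)"
  proof -
    have "(\<Sum>f\<in>S. \<Sum>g\<in>S. if g = f then a f * cnj (a g) else 0) = (\<Sum>f\<in>S. a f * cnj (a f))"
      using S by simp
    then show ?thesis by (simp only: of_real_sum complex_norm_square)
  qed
  finally show ?thesis by (simp only: of_real_eq_iff)
qed

section \<open>Point evaluation and independence of the basis\<close>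

lemma summable_kernel_series:
  assumes "0 \<le> x" "x < 1"
  shows "summable (\<lambda>n. x ^ (2 * n) / monomial_norm2 k n)"
proof (cases "x = 0")
  \<comment> \<open>Only index 0 survives, where 0^0 = 1; the asymptotic comparison below needs x >
    0.\<close>
  case True
  have "(\<lambda>n. x ^ (2 * n) / monomial_norm2 k n) = (\<lambda>n. if n = 0 then 1 / monomial_norm2 k 0 else 0)"
    using True by (auto simp: fun_eq_iff power_0_left)
  then show ?thesis by simp
next
  case False
  with assms have x: "0 < x" "x < 1" by auto
  \<comment> \<open>One of the two factors x^n absorbs the polynomial growth, the other one is
    summed as a geometric series.\<close>
  have "(\<lambda>n. real n ^ (k - 1) * x ^ (2 * n)) \<in> O(\<lambda>n. x ^ n)"
    using x by real_asymp
  moreover have "summable (\<lambda>n. norm (x ^ n))" using x by (simp add: summable_geometric)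
  ultimately have "summable (\<lambda>n. real n ^ (k - 1) * x ^ (2 * n))"
    by (rule summable_comparison_test_bigo[rotated])
  then have "summable (\<lambda>n. 1 / (2 * pi * fact (k - 2)) * (real n ^ (k - 1) * x ^ (2 * n)))"
    by (rule summable_mult)
  then show ?thesis by (simp add: monomial_norm2_def field_simps)
qed

text \<open>Cauchy-Schwarz after splitting |c_n z^n| into |z|^n / sqrt N_n times |c_n| sqrt N_n. The
  kernel series thus bounds the squared norm of evaluation at \<open>z\<close>; this single bound
  drives both inequalities of the next lemma.\<close>

lemma bergman_point_evaluation:
  assumes k: "k \<ge> 2" and h: "h \<in> bergman_space k" and z: "z \<in> punctured_disk"
  shows "(cmod (h z))\<^sup>2 \<le> (\<Sum>n. cmod z ^ (2 * n) / monomial_norm2 k n) * (bergman_norm k h)\<^sup>2"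
proof -
  obtain c where c: "c 0 = 0" "\<And>z. z \<in> punctured_disk \<Longrightarrow> (\<lambda>n. c n * z ^ n) sums h z"
    using bergman_expansion[OF k h] by blast
  let ?K = "\<lambda>n. cmod z ^ (2 * n) / monomial_norm2 k n" and ?H = "\<lambda>n. (cmod (c n))\<^sup>2 * monomial_norm2 k n"
  have K: "summable ?K" using z by (intro summable_kernel_series) (auto simp: punctured_disk_def)
  have H: "?H sums (bergman_norm k h)\<^sup>2" by (rule bergman_norm_sums[OF k h c])
  have bound: "(cmod (\<Sum>n<M. c n * z ^ n))\<^sup>2 \<le> suminf ?K * (bergman_norm k h)\<^sup>2" for M
  proof -
    have "cmod (\<Sum>n<M. c n * z ^ n) \<le> (\<Sum>n<M. sqrt (?K n) * sqrt (?H n))"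
    proof (rule order_trans[OF norm_sum], intro sum_mono)
      fix n
      have "sqrt (?K n) * sqrt (?H n) = sqrt ((cmod (c n) * cmod z ^ n)\<^sup>2)" if "n > 0"
        using monomial_norm2_pos[OF that, of k]
        by (simp add: real_sqrt_mult[symmetric] power_mult_distrib power_mult[symmetric] mult.commute)
      then show "cmod (c n * z ^ n) \<le> sqrt (?K n) * sqrt (?H n)"
        using c(1) by (cases "n = 0") (auto simp: norm_mult norm_power)
    qed
    then have "(cmod (\<Sum>n<M. c n * z ^ n))\<^sup>2 \<le> (\<Sum>n<M. sqrt (?K n) * sqrt (?H n))\<^sup>2"
      by (intro power_mono) auto
    also have "\<dots> \<le> (\<Sum>n<M. (sqrt (?K n))\<^sup>2) * (\<Sum>n<M. (sqrt (?H n))\<^sup>2)"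
      by (rule Cauchy_Schwarz_ineq_sum)
    also have "\<dots> = (\<Sum>n<M. ?K n) * (\<Sum>n<M. ?H n)"
      by (simp add: monomial_norm2_nonneg)
    also have "\<dots> \<le> suminf ?K * (bergman_norm k h)\<^sup>2"
    proof (rule mult_mono)
      show "(\<Sum>n<M. ?K n) \<le> suminf ?K"
        by (rule sum_le_suminf[OF K]) (auto simp: monomial_norm2_nonneg)
      show "(\<Sum>n<M. ?H n) \<le> (bergman_norm k h)\<^sup>2"
        unfolding sums_unique[OF H] by (rule sum_le_suminf[OF sums_summable[OF H]]) (auto simp: monomial_norm2_nonneg)
      show "0 \<le> suminf ?K" by (rule suminf_nonneg[OF K]) (simp add: monomial_norm2_nonneg)
    qed (simp add: sum_nonneg monomial_norm2_nonneg)
    finally show ?thesis .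
  qed
  have "(\<lambda>M. (cmod (\<Sum>n<M. c n * z ^ n))\<^sup>2) \<longlonglongrightarrow> (cmod (h z))\<^sup>2"
    using c(2)[OF z] unfolding sums_def by (intro tendsto_intros)
  then show ?thesis by (rule LIMSEQ_le_const2) (use bound in blast)
qed

text \<open>Point evaluation of \<open>\<Sum>f\<in>S. cnj (f z) * f\<close> bounds the finite sums over the basis from above; for the
  lower bound, the truncated monomial kernel is approximated by the span of the basis.\<close>

lemma bergman_basis_infsum:
  assumes k: "k \<ge> 2" and z: "z \<in> punctured_disk" and F: "bergman_orthonormal_basis k F"
  shows "(\<Sum>\<^sub>\<infinity>f\<in>F. (cmod (f z))\<^sup>2) = (\<Sum>n. cmod z ^ (2 * n) / monomial_norm2 k n)"
proof (rule antisym)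
  define C where "C = (\<Sum>n. cmod z ^ (2 * n) / monomial_norm2 k n)"
  have sumC: "summable (\<lambda>n. cmod z ^ (2 * n) / monomial_norm2 k n)"
    using z by (intro summable_kernel_series) (auto simp: punctured_disk_def)
  have C_nonneg: "C \<ge> 0"
    unfolding C_def by (intro suminf_nonneg sumC) (auto simp: monomial_norm2_nonneg)
  have F_space: "F \<subseteq> bergman_space k"
    and orth: "\<And>f g. f \<in> F \<Longrightarrow> g \<in> F \<Longrightarrow> bergman_inner k f g = (if f = g then 1 else 0)"
    and dense: "\<And>h e. h \<in> bergman_space k \<Longrightarrow> e > 0 \<Longrightarrow> \<exists>S c. finite S \<and> S \<subseteq> F \<and>
        bergman_norm k (\<lambda>z. h z - (\<Sum>f\<in>S. c f * f z)) < e"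
    using F unfolding bergman_orthonormal_basis_def by auto
  have norm_comb: "(bergman_norm k (\<lambda>w. \<Sum>f\<in>S. a f * f w))\<^sup>2 = (\<Sum>f\<in>S. (cmod (a f))\<^sup>2)"
    if "finite S" "S \<subseteq> F" for S a
    using that F_space by (intro bergman_norm_sum orth) auto
  have upper: "(\<Sum>f\<in>S. (cmod (f z))\<^sup>2) \<le> C" if S: "finite S" "S \<subseteq> F" for S
  proof -
    \<comment> \<open>\<open>s\<close> is at once the value of \<open>?g\<close> at \<open>z\<close>
      and the squared norm of \<open>?g\<close>, so point evaluation reads s^2 <= C s.\<close>
    define s where "s = (\<Sum>f\<in>S. (cmod (f z))\<^sup>2)"
    let ?g = "\<lambda>w. \<Sum>f\<in>S. cnj (f z) * f w"
    have "?g \<in> bergman_space k" using S F_space by (intro bergman_space_sum) auto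
    from bergman_point_evaluation[OF k this z]
    have "(cmod (?g z))\<^sup>2 \<le> C * s" using norm_comb[OF S, of "\<lambda>f. cnj (f z)"] by (simp add: C_def s_def)
    moreover have "?g z = of_real s"
      unfolding s_def of_real_sum by (intro sum.cong refl) (simp only: complex_norm_square mult.commute)
    ultimately have "s * s \<le> C * s" by (simp add: power2_eq_square)
    moreover have "s \<ge> 0" by (simp add: s_def sum_nonneg)
    ultimately have "s \<le> C" using C_nonneg by (cases "s = 0") auto
    then show ?thesis by (simp add: s_def)
  qed
  have summ: "(\<lambda>f. (cmod (f z))\<^sup>2) summable_on F"
    by (rule nonneg_bdd_above_summable_on) (auto intro!: bdd_aboveI2[where M = C] upper)
  then show "(\<Sum>\<^sub>\<infinity>f\<in>F. (cmod (f z))\<^sup>2) \<le> (\<Sum>n. cmod z ^ (2 * n) / monomial_norm2 k n)"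
    using infsum_le_finite_sums[OF summ, of C] upper by (simp add: C_def)
  define T where "T = (\<Sum>\<^sub>\<infinity>f\<in>F. (cmod (f z))\<^sup>2)"
  have T: "(\<Sum>f\<in>S. (cmod (f z))\<^sup>2) \<le> T" if "finite S" "S \<subseteq> F" for S
    unfolding T_def by (rule finite_sum_le_infsum[OF summ that]) simp
  have T_nonneg: "T \<ge> 0" using T[of "{}"] by simp
  have lower: "(\<Sum>n<N. cmod z ^ (2 * n) / monomial_norm2 k n) \<le> T" for N
  proof -
    define C' where "C' = (\<Sum>n<N. cmod z ^ (2 * n) / monomial_norm2 k n)"
    have C'_nonneg: "C' \<ge> 0" unfolding C'_def by (simp add: sum_nonneg monomial_norm2_nonneg)
    \<comment> \<open>The coefficients of the reproducing kernel at \<open>z\<close>, truncated at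
      \<open>N\<close>. As a result \<open>C'\<close> is both the value of \<open>h\<close> at
      \<open>z\<close> and the squared norm of \<open>h\<close>.\<close>
    define c where "c n = (if n < N then cnj (z ^ n) / of_real (monomial_norm2 k n) else 0)" for n
    define h where "h w = (\<Sum>n<N. c n * w ^ n)" for w
    \<comment> \<open>\<open>monomial_norm2 k 0\<close> is a quotient by 0, hence 0, and dividing by
      it gives 0 again.\<close>
    have c0: "c 0 = 0" using k by (simp add: c_def monomial_norm2_def)
    have h_sums: "(\<lambda>n. c n * w ^ n) sums h w" for w
      unfolding h_def by (rule sums_finite) (auto simp: c_def)
    have h_space: "h \<in> bergman_space k"
    proof -
      have "(\<lambda>w. \<Sum>n<M. c n * w ^ n) \<in> bergman_space k" for M
      proof (induction M)
        case 0
        then show ?case by (simp add: bergman_space_def)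
      next
        case (Suc M)
        have "(\<lambda>w. c M * w ^ M) \<in> bergman_space k"
          using monomial_in_bergman_space[OF k, of M "c M"] c0 by (cases "M = 0") (auto simp: bergman_space_def)
        then show ?case using Suc bergman_space_add by simp
      qed
      then show ?thesis unfolding h_def .
    qed
    have coeff: "(cmod (c n))\<^sup>2 * monomial_norm2 k n = cmod z ^ (2 * n) / monomial_norm2 k n"
      "c n * z ^ n = of_real (cmod z ^ (2 * n) / monomial_norm2 k n)" if "n < N" for n
    proof -
      show "(cmod (c n))\<^sup>2 * monomial_norm2 k n = cmod z ^ (2 * n) / monomial_norm2 k n"
        using that monomial_norm2_nonneg[of k n]
        by (cases "monomial_norm2 k n = 0")
           (auto simp: c_def norm_divide norm_power power_divide power_mult[symmetric] power2_eq_square[of "monomial_norm2 k n"] mult.commute)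
      have "of_real (cmod z ^ (2 * n)) = z ^ n * cnj (z ^ n)"
        by (simp only: complex_norm_square[symmetric] norm_power power_mult[symmetric] mult.commute of_real_power)
      then show "c n * z ^ n = of_real (cmod z ^ (2 * n) / monomial_norm2 k n)"
        using that by (simp add: c_def del: of_real_power complex_cnj_power)
    qed
    have h_norm: "(bergman_norm k h)\<^sup>2 = C'"
    proof -
      have "(\<lambda>n. (cmod (c n))\<^sup>2 * monomial_norm2 k n) sums (\<Sum>n<N. (cmod (c n))\<^sup>2 * monomial_norm2 k n)"
        by (rule sums_finite) (auto simp: c_def)
      moreover have "(\<Sum>n<N. (cmod (c n))\<^sup>2 * monomial_norm2 k n) = C'"
        unfolding C'_def by (intro sum.cong) (auto simp: coeff)
      ultimately show ?thesis using bergman_norm_sums[OF k h_space c0 h_sums] sums_unique2 by metis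
    qed
    have h_val: "h z = of_real C'" unfolding h_def C'_def of_real_sum by (intro sum.cong) (auto simp: coeff)
    \<comment> \<open>\<open>p\<close> is a combination of basis elements within \<open>t\<close> of
      \<open>h\<close>. Its value at \<open>z\<close> is at most sqrt T times its norm, by
      Cauchy-Schwarz over \<open>S\<close>; the remainder is controlled by point evaluation. To
      bound the norm of \<open>p\<close>, (x + y)^2 <= (1 + t) x^2 + (1 + 1/t) y^2 is integrated.
      Taking the accuracy \<open>t\<close> as its parameter turns the second term into t^2 + t,
      which vanishes with \<open>t\<close>.\<close>
    have approx: "C' \<le> sqrt T * sqrt ((1 + t) * C' + (t\<^sup>2 + t)) + sqrt C * t" if t: "t > 0" for t
    proof -
      obtain S a where S: "finite S" "S \<subseteq> F" and small: "bergman_norm k (\<lambda>w. h w - (\<Sum>f\<in>S. a f * f w)) < t"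
        using dense[OF h_space t] by blast
      define p where "p w = (\<Sum>f\<in>S. a f * f w)" for w
      have p_space: "p \<in> bergman_space k"
        unfolding p_def using S F_space by (intro bergman_space_sum) auto
      have d_space: "(\<lambda>w. h w - p w) \<in> bergman_space k" by (rule bergman_space_diff[OF h_space p_space])
      have d2: "(bergman_norm k (\<lambda>w. h w - p w))\<^sup>2 \<le> t\<^sup>2"
        using small bergman_norm_nonneg unfolding p_def by (intro power_mono) auto
      have "(bergman_norm k p)\<^sup>2 \<le> (1 + t) * (bergman_norm k h)\<^sup>2 + (1 + 1 / t) * (bergman_norm k (\<lambda>w. h w - p w))\<^sup>2"
      proof -
        have "(LINT w|poincare_measure. (cmod (p w))\<^sup>2 * log_weight w ^ k) \<le>
            (LINT w|poincare_measure. (1 + t) * ((cmod (h w))\<^sup>2 * log_weight w ^ k) +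
              (1 + 1 / t) * ((cmod (h w - p w))\<^sup>2 * log_weight w ^ k))"
        proof (rule integral_mono)
          fix w assume "w \<in> space poincare_measure"
          then have L: "0 \<le> log_weight w ^ k" by (simp add: log_weight_power_nonneg)
          have "cmod (p w) \<le> cmod (h w) + cmod (h w - p w)"
            using norm_triangle_ineq4[of "h w" "h w - p w"] by simp
          then have "(cmod (p w))\<^sup>2 \<le> (cmod (h w) + cmod (h w - p w))\<^sup>2" by (intro power_mono) auto
          also have "\<dots> \<le> (1 + t) * (cmod (h w))\<^sup>2 + (1 + 1 / t) * (cmod (h w - p w))\<^sup>2"
          proof -
            have "(1 + t) * x\<^sup>2 + (1 + 1 / t) * y\<^sup>2 - (x + y)\<^sup>2 = (t * x - y)\<^sup>2 / t" for x y :: real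
              using t by (simp add: field_simps power2_eq_square)
            moreover have "(t * x - y)\<^sup>2 / t \<ge> 0" for x y :: real using t by simp
            ultimately show ?thesis by (smt (verit, best))
          qed
          finally have "(cmod (p w))\<^sup>2 * log_weight w ^ k \<le>
              ((1 + t) * (cmod (h w))\<^sup>2 + (1 + 1 / t) * (cmod (h w - p w))\<^sup>2) * log_weight w ^ k"
            by (rule mult_right_mono[OF _ L])
          then show "(cmod (p w))\<^sup>2 * log_weight w ^ k \<le> (1 + t) * ((cmod (h w))\<^sup>2 * log_weight w ^ k) +
              (1 + 1 / t) * ((cmod (h w - p w))\<^sup>2 * log_weight w ^ k)"
            by (simp add: algebra_simps)
        qed (intro Bochner_Integration.integrable_add integrable_mult_right
              bergman_spaceD(3)[OF p_space] bergman_spaceD(3)[OF h_space] bergman_spaceD(3)[OF d_space])+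
        then show ?thesis unfolding bergman_norm_square
          by (subst (asm) Bochner_Integration.integral_add)
             (auto intro!: integrable_mult_right bergman_spaceD(3)[OF h_space] bergman_spaceD(3)[OF d_space])
      qed
      also have "\<dots> \<le> (1 + t) * C' + (1 + 1 / t) * t\<^sup>2"
        using d2 t by (intro add_mono mult_left_mono) (auto simp: h_norm)
      also have "(1 + 1 / t) * t\<^sup>2 = t\<^sup>2 + t" using t by (simp add: field_simps power2_eq_square)
      finally have coeffs: "(\<Sum>f\<in>S. (cmod (a f))\<^sup>2) \<le> (1 + t) * C' + (t\<^sup>2 + t)"
        using norm_comb[OF S, of a] unfolding p_def by simp
      have "cmod (p z) \<le> (\<Sum>f\<in>S. cmod (f z) * cmod (a f))"
        unfolding p_def by (rule order_trans[OF norm_sum]) (simp add: norm_mult mult.commute)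
      then have "(cmod (p z))\<^sup>2 \<le> (\<Sum>f\<in>S. cmod (f z) * cmod (a f))\<^sup>2" by (intro power_mono) auto
      also have "\<dots> \<le> (\<Sum>f\<in>S. (cmod (f z))\<^sup>2) * (\<Sum>f\<in>S. (cmod (a f))\<^sup>2)"
        by (rule Cauchy_Schwarz_ineq_sum)
      also have "\<dots> \<le> T * ((1 + t) * C' + (t\<^sup>2 + t))"
        by (intro mult_mono T[OF S] coeffs T_nonneg sum_nonneg) auto
      finally have "(cmod (p z))\<^sup>2 \<le> T * ((1 + t) * C' + (t\<^sup>2 + t))" .
      then have "cmod (p z) \<le> sqrt T * sqrt ((1 + t) * C' + (t\<^sup>2 + t))"
        unfolding real_sqrt_mult[symmetric] by (rule real_le_rsqrt)
      moreover have "cmod (h z - p z) \<le> sqrt C * t"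
      proof -
        have "(cmod (h z - p z))\<^sup>2 \<le> C * t\<^sup>2"
          using bergman_point_evaluation[OF k d_space z] mult_left_mono[OF d2 C_nonneg] by (simp add: C_def)
        then have "cmod (h z - p z) \<le> sqrt (C * t\<^sup>2)" by (rule real_le_rsqrt)
        then show ?thesis using t by (simp add: real_sqrt_mult)
      qed
      moreover have "C' \<le> cmod (p z) + cmod (h z - p z)"
        using norm_triangle_ineq[of "p z" "h z - p z"] C'_nonneg by (simp add: h_val)
      ultimately show ?thesis by linarith
    qed
    have "((\<lambda>t. sqrt T * sqrt ((1 + t) * C' + (t\<^sup>2 + t)) + sqrt C * t) \<longlongrightarrow>
        sqrt T * sqrt ((1 + 0) * C' + (0\<^sup>2 + 0)) + sqrt C * 0) (at_right 0)"
      by (intro tendsto_intros)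
    then have "C' \<le> sqrt T * sqrt ((1 + 0) * C' + (0\<^sup>2 + 0)) + sqrt C * 0"
      by (rule tendsto_lowerbound) (auto simp: eventually_at_right_less intro!: eventually_mono[OF eventually_at_right_less] approx)
    \<comment> \<open>In the limit C' <= sqrt T sqrt C'; cancelling sqrt C' gives C' <= T.\<close>
    then have "C' \<le> sqrt T * sqrt C'" by simp
    moreover have "C' = sqrt C' * sqrt C'" using C'_nonneg by simp
    ultimately have "sqrt C' * sqrt C' \<le> sqrt T * sqrt C'" by linarith
    then have "sqrt C' \<le> sqrt T" if "C' > 0"
      by (rule mult_right_le_imp_le) (use that in simp)
    then have "C' \<le> T" using T_nonneg C'_nonneg by (cases "C' = 0") auto
    then show ?thesis by (simp add: C'_def)
  qed
  show "(\<Sum>n. cmod z ^ (2 * n) / monomial_norm2 k n) \<le> (\<Sum>\<^sub>\<infinity>f\<in>F. (cmod (f z))\<^sup>2)"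
    using suminf_le_const[OF sumC lower] unfolding T_def .
qed

text \<open>The rotation by pi/(n - m) multiplies the integrand by exp(i pi) = -1 but preserves the
  integral, which must therefore be 0.\<close>

lemma bergman_inner_monomials_orthogonal:
  assumes "n \<noteq> m"
  shows "bergman_inner k (\<lambda>z. z ^ n) (\<lambda>z. z ^ m) = 0"
proof -
  define W where "W z = indicator punctured_disk z * (2 / ((cmod z)\<^sup>2 * (log_weight z)\<^sup>2) * log_weight z ^ k)" for z
  have [measurable]: "W \<in> borel_measurable borel" unfolding W_def by measurable
  define G where "G z = z ^ n * cnj z ^ m * of_real (W z)" for z
  have [measurable]: "cnj \<in> borel_measurable borel"
    by (intro borel_measurable_continuous_onI continuous_intros)
  have [measurable]: "G \<in> borel_measurable borel" unfolding G_def by measurable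
  have "bergman_inner k (\<lambda>z. z ^ n) (\<lambda>z. z ^ m) =
      (LINT z|restrict_space lborel punctured_disk. (2 / ((cmod z)\<^sup>2 * (log_weight z)\<^sup>2)) *\<^sub>R
        (z ^ n * cnj (z ^ m) * of_real (log_weight z ^ k)))"
    unfolding bergman_inner_def poincare_measure_def
  proof (rule integral_density)
    show "(\<lambda>z. z ^ n * cnj (z ^ m) * of_real (log_weight z ^ k)) \<in> borel_measurable (restrict_space lborel punctured_disk)"
      by (intro measurable_restrict_space1) simp
    show "(\<lambda>z. 2 / ((cmod z)\<^sup>2 * (log_weight z)\<^sup>2)) \<in> borel_measurable (restrict_space lborel punctured_disk)"
      by (intro measurable_restrict_space1) simp
  qed auto
  also have "\<dots> = (LINT z|lborel. indicator punctured_disk z *\<^sub>R ((2 / ((cmod z)\<^sup>2 * (log_weight z)\<^sup>2)) *\<^sub>R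
        (z ^ n * cnj (z ^ m) * of_real (log_weight z ^ k))))"
    by (rule integral_restrict_space) simp
  also have "\<dots> = (LINT z|lborel. G z)"
    by (intro Bochner_Integration.integral_cong refl)
       (simp add: G_def W_def scaleR_conv_of_real ac_simps indicator_def)
  finally have inner: "bergman_inner k (\<lambda>z. z ^ n) (\<lambda>z. z ^ m) = (LINT z|lborel. G z)" .
  define \<theta> where "\<theta> = pi / (real n - real m)"
  define c where "c = cis \<theta>"
  have norm_c: "cmod c = 1" "c \<noteq> 0" by (auto simp: c_def)
  have "c ^ n * cnj c ^ m = -1"
  proof -
    have "c ^ n * cnj c ^ m = cis (real n * \<theta> + real m * (- \<theta>))"
      unfolding c_def cis_cnj by (simp only: Complex.DeMoivre cis_mult)
    also have "real n * \<theta> + real m * (- \<theta>) = pi"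
    proof -
      have "real n * \<theta> + real m * (- \<theta>) = (real n - real m) * \<theta>" by (simp add: left_diff_distrib)
      then show ?thesis using assms by (simp add: \<theta>_def)
    qed
    finally show ?thesis by simp
  qed
  moreover have "G (c * z) = c ^ n * cnj c ^ m * G z" for z
  proof -
    have "W (c * z) = W z"
      by (simp add: W_def log_weight_def punctured_disk_def norm_mult norm_c indicator_def)
    then show ?thesis by (simp add: G_def power_mult_distrib ac_simps)
  qed
  ultimately have G_rot: "G (c * z) = - G z" for z by simp
  have "(LINT z|lborel. G z) = (LINT z|distr lborel borel (\<lambda>z. c * z). G z)"
    by (simp only: lborel_distr_rotate[OF norm_c(1)])
  also have "\<dots> = (LINT z|lborel. G (c * z))" by (rule integral_distr) auto
  also have "\<dots> = - (LINT z|lborel. G z)" unfolding G_rot by simp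
  finally show ?thesis unfolding inner by (simp add: eq_neg_iff_add_eq_0 mult_2[symmetric])
qed

definition normalized_monomial :: "nat \<Rightarrow> nat \<Rightarrow> complex \<Rightarrow> complex" where
  "normalized_monomial k n z = z ^ n / of_real (sqrt (monomial_norm2 k n))"

lemma normalized_monomial_in_space:
  assumes "k \<ge> 2" "n > 0"
  shows "normalized_monomial k n \<in> bergman_space k"
  using monomial_in_bergman_space[OF assms, of "1 / of_real (sqrt (monomial_norm2 k n))"]
  unfolding normalized_monomial_def[abs_def] by simp

lemma bergman_inner_normalized_monomial:
  assumes k: "k \<ge> 2" and n: "n > 0"
  shows "bergman_inner k (normalized_monomial k n) (normalized_monomial k m) = (if n = m then 1 else 0)"
proof (cases "n = m")
  case True
  let ?c = "\<lambda>j. if j = n then complex_of_real (1 / sqrt (monomial_norm2 k n)) else 0"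
  have "(\<lambda>j. ?c j * z ^ j) sums normalized_monomial k n z" for z
    using sums_single[of n "\<lambda>j. complex_of_real (1 / sqrt (monomial_norm2 k n)) * z ^ j"]
    by (simp add: normalized_monomial_def if_distrib[of "\<lambda>x. x * _"] cong: if_cong)
  then have "(\<lambda>j. (cmod (?c j))\<^sup>2 * monomial_norm2 k j) sums (bergman_norm k (normalized_monomial k n))\<^sup>2"
    using n by (intro bergman_norm_sums[OF k normalized_monomial_in_space[OF k n]]) auto
  moreover have "(\<lambda>j. (cmod (?c j))\<^sup>2 * monomial_norm2 k j) = (\<lambda>j. if j = n then 1 else 0)"
    using monomial_norm2_pos[OF n, of k] by (auto simp: norm_divide power_divide)
  ultimately have "(bergman_norm k (normalized_monomial k n))\<^sup>2 = 1"
    using sums_single[of n "\<lambda>_. 1::real"] sums_unique2 by metis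
  then show ?thesis using True bergman_inner_self[of k "normalized_monomial k n"] by simp
next
  case False
  define a where "a = 1 / (of_real (sqrt (monomial_norm2 k n)) * of_real (sqrt (monomial_norm2 k m)) :: complex)"
  have "bergman_inner k (normalized_monomial k n) (normalized_monomial k m) =
      (LINT z|poincare_measure. a * (z ^ n * cnj (z ^ m) * of_real (log_weight z ^ k)))"
    unfolding bergman_inner_def normalized_monomial_def
    by (intro Bochner_Integration.integral_cong refl) (simp add: a_def)
  also have "\<dots> = a * bergman_inner k (\<lambda>z. z ^ n) (\<lambda>z. z ^ m)"
    unfolding bergman_inner_def by (rule integral_mult_right_zero)
  finally show ?thesis using False by (simp add: bergman_inner_monomials_orthogonal)
qed

text \<open>A basis is a set of functions, so sums over it have to be reindexed by exponents. If two
  normalised monomials of different exponents coincided, their inner product would be both 1 and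
  0.\<close>

lemma inj_on_normalized_monomial:
  assumes "k \<ge> 2"
  shows "inj_on (normalized_monomial k) {0<..}"
proof (rule inj_onI)
  fix n m assume "n \<in> {0<..}" "m \<in> {0<..}" "normalized_monomial k n = normalized_monomial k m"
  then show "n = m"
    using bergman_inner_normalized_monomial[OF assms, of n n]
      bergman_inner_normalized_monomial[OF assms, of n m] by (auto split: if_splits)
qed

lemma normalized_monomials_basis:
  assumes k: "k \<ge> 2"
  shows "bergman_orthonormal_basis k (normalized_monomial k ` {0<..})"
  unfolding bergman_orthonormal_basis_def
proof (intro conjI ballI allI impI)
  show "normalized_monomial k ` {0<..} \<subseteq> bergman_space k"
    using normalized_monomial_in_space[OF k] by auto
next
  fix f g assume "f \<in> normalized_monomial k ` {0<..}" "g \<in> normalized_monomial k ` {0<..}"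
  then obtain n m where nm: "n > 0" "m > 0" "f = normalized_monomial k n" "g = normalized_monomial k m"
    by auto
  then have "f = g \<longleftrightarrow> n = m" using inj_on_normalized_monomial[OF k] by (auto simp: inj_on_def)
  then show "bergman_inner k f g = (if f = g then 1 else 0)"
    using bergman_inner_normalized_monomial[OF k nm(1), of m] nm by simp
next
  fix h :: "complex \<Rightarrow> complex" and e :: real
  assume h: "h \<in> bergman_space k" and e: "e > 0"
  obtain c where c: "c 0 = 0" "\<And>z. z \<in> punctured_disk \<Longrightarrow> (\<lambda>n. c n * z ^ n) sums h z"
    using bergman_expansion[OF k h] by blast
  let ?t = "\<lambda>n. (cmod (c n))\<^sup>2 * monomial_norm2 k n"
  have t: "?t sums (bergman_norm k h)\<^sup>2" by (rule bergman_norm_sums[OF k h c])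
  have "(\<lambda>M. (\<Sum>n<M. ?t n)) \<longlonglongrightarrow> (bergman_norm k h)\<^sup>2" using t by (simp add: sums_def)
  moreover have "(bergman_norm k h)\<^sup>2 - e\<^sup>2 < (bergman_norm k h)\<^sup>2" using e by simp
  ultimately have "\<forall>\<^sub>F M in sequentially. (bergman_norm k h)\<^sup>2 - e\<^sup>2 < (\<Sum>n<M. ?t n)"
    by (rule order_tendstoD)
  then obtain M where M: "(bergman_norm k h)\<^sup>2 - e\<^sup>2 < (\<Sum>n<M. ?t n)"
    by (auto simp: eventually_sequentially)
  define S where "S = normalized_monomial k ` {0<..<M}"
  \<comment> \<open>Coefficients are indexed by functions here, so the exponent is recovered from
    the monomial; the square root undoes the normalisation.\<close>
  define a where "a f = (let n = inv_into {0<..} (normalized_monomial k) f in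
      c n * of_real (sqrt (monomial_norm2 k n)))" for f
  have S: "finite S" "S \<subseteq> normalized_monomial k ` {0<..}" by (auto simp: S_def)
  have comb: "(\<Sum>f\<in>S. a f * f z) = (\<Sum>n<M. c n * z ^ n)" for z
  proof -
    have "(\<Sum>f\<in>S. a f * f z) = (\<Sum>n\<in>{0<..<M}. a (normalized_monomial k n) * normalized_monomial k n z)"
      unfolding S_def
      by (subst sum.reindex) (auto intro: inj_on_subset[OF inj_on_normalized_monomial[OF k]])
    also have "\<dots> = (\<Sum>n\<in>{0<..<M}. c n * z ^ n)"
    proof (intro sum.cong refl)
      fix n assume n: "n \<in> {0<..<M}"
      then have "a (normalized_monomial k n) = c n * of_real (sqrt (monomial_norm2 k n))"
        using inj_on_normalized_monomial[OF k] by (simp add: a_def inv_into_f_f)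
      then show "a (normalized_monomial k n) * normalized_monomial k n z = c n * z ^ n"
        using n monomial_norm2_pos[of n k] by (simp add: normalized_monomial_def)
    qed
    \<comment> \<open>Exponent 0 may be added because c 0 = 0.\<close>
    also have "\<dots> = (\<Sum>n<M. c n * z ^ n)"
      by (rule sum.mono_neutral_left) (use c(1) in \<open>auto simp: not_less\<close>)
    finally show ?thesis .
  qed
  let ?r = "\<lambda>z. h z - (\<Sum>f\<in>S. a f * f z)"
  have r_space: "?r \<in> bergman_space k"
    using S normalized_monomial_in_space[OF k]
    by (intro bergman_space_diff h bergman_space_sum) auto
  \<comment> \<open>The remainder has the tail of the expansion of \<open>h\<close> as its power
    series. Its squared norm is then the tail of a convergent Parseval series.\<close>
  let ?c = "\<lambda>n. if n < M then 0 else c n"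
  have "(\<lambda>n. ?c n * z ^ n) sums ?r z" if "z \<in> punctured_disk" for z
  proof -
    have "(\<lambda>n. c n * z ^ n - (if n < M then c n * z ^ n else 0)) sums (h z - (\<Sum>n<M. c n * z ^ n))"
      using sums_If_finite_set[of "{..<M}" "\<lambda>n. c n * z ^ n"] by (intro sums_diff c(2) that) simp
    then show ?thesis unfolding comb by (rule sums_cong[THEN iffD1, rotated]) auto
  qed
  then have "(\<lambda>n. (cmod (?c n))\<^sup>2 * monomial_norm2 k n) sums (bergman_norm k ?r)\<^sup>2"
    using c(1) by (intro bergman_norm_sums[OF k r_space]) auto
  moreover have "(\<lambda>n. (cmod (?c n))\<^sup>2 * monomial_norm2 k n) sums ((bergman_norm k h)\<^sup>2 - (\<Sum>n<M. ?t n))"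
  proof -
    have "(\<lambda>n. ?t n - (if n < M then ?t n else 0)) sums ((bergman_norm k h)\<^sup>2 - (\<Sum>n<M. ?t n))"
      using sums_If_finite_set[of "{..<M}" ?t] by (intro sums_diff t) simp
    then show ?thesis by (rule sums_cong[THEN iffD1, rotated]) auto
  qed
  ultimately have "(bergman_norm k ?r)\<^sup>2 = (bergman_norm k h)\<^sup>2 - (\<Sum>n<M. ?t n)" by (rule sums_unique2)
  then have "(bergman_norm k ?r)\<^sup>2 < e\<^sup>2" using M by simp
  then have "bergman_norm k ?r < e" by (rule power_less_imp_less_base) (use e in simp)
  then show "\<exists>S c. finite S \<and> S \<subseteq> normalized_monomial k ` {0<..} \<and>
      bergman_norm k (\<lambda>z. h z - (\<Sum>f\<in>S. c f * f z)) < e"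
    using S by blast
qed

theorem bergman_kernel_function_eq:
  assumes k: "k \<ge> 2" and z: "z \<in> punctured_disk"
  shows "bergman_kernel_function k z = log_weight z ^ k * (\<Sum>n. cmod z ^ (2 * n) / monomial_norm2 k n)"
  unfolding bergman_kernel_function_def
  by (subst bergman_basis_infsum[OF k z someI[of "bergman_orthonormal_basis k", OF normalized_monomials_basis[OF k]]])
     (rule refl)

section \<open>Stirling's lower bound and the Laplace sum\<close>

text \<open>The logarithm of n! / (n^(n + 1/2) exp(-n)), which decreases to ln sqrt(2 pi).\<close>

definition stirling_defect :: "nat \<Rightarrow> real" where
  "stirling_defect n = ln (fact n) - (real n + 1 / 2) * ln (real n) + real n"

lemma stirling_defect_Suc:
  assumes "n > 0"
  shows "stirling_defect n - stirling_defect (Suc n) =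
    (real n + 1 / 2) * (ln (real n + 1) - ln (real n)) - 1"
proof -
  have "ln (fact (Suc n) :: real) = ln (real n + 1) + ln (fact n)"
    by (simp add: ln_mult add.commute)
  then show ?thesis unfolding stirling_defect_def by (simp add: algebra_simps)
qed

text \<open>Each decrement is (n + 1/2) (ln(n + 1) - ln n) - 1. It is nonnegative by the midpoint
  estimate of the integral of the convex function 1/x over [n, n + 1].\<close>

lemma stirling_defect_antimono:
  assumes "0 < m" "m \<le> n"
  shows "stirling_defect n \<le> stirling_defect m"
  using assms(2)
proof (induction n rule: dec_induct)
  case (step n)
  with assms have n: "n > 0" by simp
  have "2 * (real n + 1 - real n) / (real n + (real n + 1)) \<le> ln (real n + 1) - ln (real n)"
    by (rule ln_inverse_approx_ge) (use n in auto)
  then have "(real n + 1 / 2) * (2 / (2 * real n + 1)) \<le>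
      (real n + 1 / 2) * (ln (real n + 1) - ln (real n))"
    by (intro mult_left_mono) auto
  moreover have "(real n + 1 / 2) * (2 / (2 * real n + 1)) = 1" by (simp add: field_simps)
  ultimately show ?case using stirling_defect_Suc[OF n] step.IH by linarith
qed simp

text \<open>The trapezoidal estimate of the same integral bounds the decrement by 1/(4n) - 1/(4(n +
  1)), which telescopes. The resulting lower bound makes the decreasing sequence converge.\<close>

lemma stirling_defect_lower:
  assumes "n > 0"
  shows "stirling_defect 1 - 1 / 4 \<le> stirling_defect n - 1 / (4 * real n)"
proof -
  have "1 \<le> n" using assms by simp
  then show ?thesis
  proof (induction n rule: dec_induct)
    case (step n)
    then have n: "n > 0" by simp
    have "ln (real n + 1) - ln (real n) \<le> 1 * (inverse (real n) + inverse (real n + 1)) / 2"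
      by (rule ln_inverse_approx_le) (use n in auto)
    then have "(real n + 1 / 2) * (ln (real n + 1) - ln (real n)) \<le>
        (real n + 1 / 2) * (1 * (inverse (real n) + inverse (real n + 1)) / 2)"
      by (intro mult_left_mono) auto
    also have "\<dots> = 1 + 1 / (4 * real n) - 1 / (4 * (real n + 1))"
      using n by (simp add: divide_simps) (simp add: algebra_simps)
    finally have "(real n + 1 / 2) * (ln (real n + 1) - ln (real n)) \<le> \<dots>" .
    then show ?case using stirling_defect_Suc[OF n] step.IH by (simp add: add.commute)
  qed simp
qed

text \<open>The squared quotient is that of 4^n and the central binomial coefficient; in this form
  Wallis' product can be compared with factorials.\<close>

lemma wallis_prod_fact:
  "(\<Prod>k=1..n. (4 * real k ^ 2) / (4 * real k ^ 2 - 1)) =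
     (4 ^ n * fact n ^ 2 / fact (2 * n)) ^ 2 / (2 * real n + 1)"
proof (induction n)
  case (Suc n)
  define W where "W n = (4 ^ n * fact n ^ 2 / fact (2 * n) :: real)" for n
  have "fact (2 * Suc n) = (2 * real n + 2) * (2 * real n + 1) * fact (2 * n)"
    by (simp add: algebra_simps)
  then have W: "W (Suc n) = W n * (2 * (real n + 1) / (2 * real n + 1))"
    unfolding W_def by (simp add: divide_simps) (simp add: algebra_simps power2_eq_square)
  have "4 * real (Suc n) ^ 2 - 1 = (2 * real n + 1) * (2 * real n + 3)"
    by (simp add: algebra_simps power2_eq_square)
  then have "(\<Prod>k=1..Suc n. (4 * real k ^ 2) / (4 * real k ^ 2 - 1)) =
      W n ^ 2 / (2 * real n + 1) * (4 * (real n + 1) ^ 2 / ((2 * real n + 1) * (2 * real n + 3)))"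
    using Suc.IH unfolding W_def by (simp add: add.commute)
  also have "\<dots> = W (Suc n) ^ 2 / (2 * real (Suc n) + 1)"
  proof -
    have "w ^ 2 / y * (4 * x ^ 2 / (y * z)) = (w * (2 * x / y)) ^ 2 / z" for w x y z :: real
      by (simp add: power_mult_distrib power_divide power2_eq_square ac_simps)
    moreover have "2 * real (Suc n) + 1 = 2 * real n + 3" by simp
    ultimately show ?thesis unfolding W by simp
  qed
  finally show ?case unfolding W_def .
qed simp

text \<open>This combination has the same limit as the sequence itself. In it the terms n ln n and n
  cancel, and the Wallis quotient is left.\<close>

lemma stirling_defect_double:
  assumes "n > 0"
  shows "2 * stirling_defect n - stirling_defect (2 * n) =
    ln (4 ^ n * fact n ^ 2 / fact (2 * n)) + ln 2 / 2 - ln (real n) / 2"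
proof -
  have "ln (4 ^ n :: real) = 2 * real n * ln 2"
    using ln_realpow[of 4 n] ln_realpow[of 2 2] by simp
  then have "ln (4 ^ n * fact n ^ 2 / fact (2 * n) :: real) =
      2 * real n * ln 2 + 2 * ln (fact n) - ln (fact (2 * n))"
    by (simp add: ln_mult ln_div ln_realpow)
  then show ?thesis using assms
    unfolding stirling_defect_def by (simp add: ln_mult algebra_simps)
qed

text \<open>A decreasing sequence stays above its limit, and the limit is identified by computing 2L
  - L from Wallis' product.\<close>

lemma stirling_defect_ge:
  assumes "n > 0"
  shows "ln (sqrt (2 * pi)) \<le> stirling_defect n"
proof -
  let ?d = "\<lambda>n. stirling_defect (Suc n)"
  have "decseq ?d" by (rule decseq_SucI) (auto intro: stirling_defect_antimono)
  moreover have "stirling_defect 1 - 1 / 4 \<le> ?d n" for n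
    using stirling_defect_lower[of "Suc n"] by (smt (verit) divide_nonneg_nonneg of_nat_0_le_iff zero_less_Suc)
  ultimately obtain L where "?d \<longlonglongrightarrow> L" and L: "\<And>i. L \<le> ?d i"
    using decseq_convergent[of ?d] by blast
  then have lim: "stirling_defect \<longlonglongrightarrow> L" by (simp only: filterlim_sequentially_Suc)
  have "filterlim (\<lambda>n::nat. 2 * n) sequentially sequentially"
    by (rule filterlim_subseq) (simp add: strict_mono_def)
  from filterlim_compose[OF lim this]
  have lim2: "(\<lambda>n. stirling_defect (2 * n)) \<longlonglongrightarrow> L" .
  have "(\<lambda>n. 2 * stirling_defect n - stirling_defect (2 * n)) \<longlonglongrightarrow> 2 * L - L"
    by (intro tendsto_intros lim lim2)
  define W where "W n = (4 ^ n * fact n ^ 2 / fact (2 * n) :: real)" for n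
  have Wpos: "W n > 0" for n unfolding W_def by simp
  have "(\<lambda>n. W n ^ 2 / (2 * real n + 1)) \<longlonglongrightarrow> pi / 2"
    using wallis unfolding wallis_prod_fact W_def .
  then have "(\<lambda>n. ln (W n ^ 2 / (2 * real n + 1))) \<longlonglongrightarrow> ln (pi / 2)"
    by (rule tendsto_ln) simp
  moreover have "(\<lambda>n. ln (2 * real n + 1) - ln (real n)) \<longlonglongrightarrow> ln 2" by real_asymp
  ultimately have "(\<lambda>n. (ln (W n ^ 2 / (2 * real n + 1)) + (ln (2 * real n + 1) - ln (real n))) / 2 + ln 2 / 2)
      \<longlonglongrightarrow> (ln (pi / 2) + ln 2) / 2 + ln 2 / 2"
    by (intro tendsto_divide tendsto_add tendsto_const) auto
  moreover have "\<forall>\<^sub>F n in sequentially. (ln (W n ^ 2 / (2 * real n + 1)) + (ln (2 * real n + 1) - ln (real n))) / 2 + ln 2 / 2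
      = 2 * stirling_defect n - stirling_defect (2 * n)"
    using eventually_gt_at_top[of 0]
  proof eventually_elim
    case (elim n)
    have "ln (W n ^ 2 / (2 * real n + 1)) = 2 * ln (W n) - ln (2 * real n + 1)"
      using Wpos[of n] by (simp add: ln_div ln_realpow)
    then show ?case using stirling_defect_double[OF elim] unfolding W_def by simp
  qed
  ultimately have "(\<lambda>n. 2 * stirling_defect n - stirling_defect (2 * n)) \<longlonglongrightarrow> (ln (pi / 2) + ln 2) / 2 + ln 2 / 2"
    by (rule Lim_transform_eventually)
  then have "2 * L - L = (ln (pi / 2) + ln 2) / 2 + ln 2 / 2"
    using \<open>(\<lambda>n. 2 * stirling_defect n - stirling_defect (2 * n)) \<longlonglongrightarrow> 2 * L - L\<close>
    by (intro LIMSEQ_unique)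
  also have "\<dots> = ln (sqrt (2 * pi))"
    by (simp add: ln_sqrt ln_mult ln_div field_simps)
  finally show ?thesis using L[of "n - 1"] assms by simp
qed

lemma stirling_lower_bound:
  assumes "n > 0"
  shows "sqrt (2 * pi) * (real n powr (real n + 1 / 2) * exp (- real n)) \<le> fact n"
proof -
  have "ln (sqrt (2 * pi) * (real n powr (real n + 1 / 2) * exp (- real n))) =
      ln (sqrt (2 * pi)) + (real n + 1 / 2) * ln (real n) - real n"
    using assms by (simp add: ln_mult ln_powr)
  also have "\<dots> \<le> ln (fact n)"
    using stirling_defect_ge[OF assms] unfolding stirling_defect_def by linarith
  finally show ?thesis using assms by (subst (asm) ln_le_cancel_iff) auto
qed

section \<open>Geometric domination of the Laplace sum\<close>

lemma ln_upper_cubic: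
  fixes x :: real
  assumes "0 \<le> x"
  shows "ln (1 + x) - x \<le> - (x ^ 2 / 2) + x ^ 3 / 3"
proof -
  let ?g = "\<lambda>x::real. x - x ^ 2 / 2 + x ^ 3 / 3 - ln (1 + x)"
  have "?g 0 \<le> ?g x"
  proof (rule DERIV_nonneg_imp_nondecreasing[OF assms])
    fix y :: real assume y: "0 \<le> y"
    have "(?g has_real_derivative 1 - y + y ^ 2 - 1 / (1 + y)) (at y)"
      using y by (auto intro!: derivative_eq_intros simp: power2_eq_square)
    moreover have "1 - y + y ^ 2 - 1 / (1 + y) = y ^ 3 / (1 + y)"
      using y by (simp add: field_simps power2_eq_square power3_eq_cube)
    ultimately show "\<exists>z. (?g has_real_derivative z) (at y) \<and> 0 \<le> z"
      using y by (intro exI[of _ "1 - y + y ^ 2 - 1 / (1 + y)"]) auto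
  qed
  then show ?thesis by simp
qed

text \<open>The cubic Taylor term on this side is -x^3/3. The weaker +x^3/3 repeats the bound for
  ln(1 + x) - x, so that the one hypothesis on \<open>b\<close>, read at x = 1/b, covers both
  neighbours of the peak.\<close>

lemma ln_upper_neg:
  fixes x :: real
  assumes "0 \<le> x" "x < 1"
  shows "ln (1 - x) + x \<le> - (x ^ 2 / 2) + x ^ 3 / 3"
proof -
  let ?g = "\<lambda>x::real. - x - x ^ 2 / 2 + x ^ 3 / 3 - ln (1 - x)"
  have "?g 0 \<le> ?g x"
  proof (rule DERIV_nonneg_imp_nondecreasing[OF assms(1)])
    fix y :: real assume y: "0 \<le> y" "y \<le> x"
    have "(?g has_real_derivative - 1 - y + y ^ 2 + 1 / (1 - y)) (at y)"
      using y assms by (auto intro!: derivative_eq_intros simp: power2_eq_square)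
    moreover have "- 1 - y + y ^ 2 + 1 / (1 - y) = y ^ 2 * (2 - y) / (1 - y)"
      using y assms by (simp add: field_simps power2_eq_square power3_eq_cube)
    ultimately show "\<exists>z. (?g has_real_derivative z) (at y) \<and> 0 \<le> z"
      using y assms
      by (intro exI[of _ "- 1 - y + y ^ 2 + 1 / (1 - y)"]) auto
  qed
  then show ?thesis by simp
qed

text \<open>1 + h lies at fraction 1/j on the segment from 1 to 1 + jh, where the concave
  \<open>ln\<close> is above its chord. The sign of \<open>h\<close> is free: 1/b serves the terms
  after the peak, -1/b those before it.\<close>

lemma ln_deviation_scale:
  fixes h :: real
  assumes j: "j \<ge> 1" and pos: "1 + j * h > 0"
  shows "ln (1 + j * h) - j * h \<le> j * (ln (1 + h) - h)"
proof -
  have "1 / j * ln (1 + j * h) + (1 - 1 / j) * ln 1 \<le> ln (1 / j * (1 + j * h) + (1 - 1 / j) * 1)"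
    using concave_onD[OF ln_concave, of "1 / j" 1 "1 + j * h"] j pos by (simp add: algebra_simps)
  moreover have e: "1 / j * (1 + j * h) + (1 - 1 / j) * 1 = 1 + h" using j by (simp add: field_simps)
  ultimately have "ln (1 + j * h) / j \<le> ln (1 + h)" unfolding e by simp
  then have "ln (1 + j * h) \<le> j * ln (1 + h)" using j by (simp add: field_simps)
  then show ?thesis by (simp add: algebra_simps)
qed

text \<open>Each term is dominated by \<open>q\<close> to the power of its distance from the peak a
  = b. The terms from b on give 1/(1 - q), those below b give at most q/(1 - q).\<close>

lemma laplace_sum_bound:
  fixes k b :: nat
  assumes k: "k \<ge> 2" and b: "b > 0"
    and le: "real k / (2 * real b ^ 2) - real k / (3 * real b ^ 3) \<ge> 3 * ln (real k)"
  defines "t \<equiv> \<lambda>a::nat. (real a / real b * exp (1 - real a / real b)) ^ k"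
    and "q \<equiv> 1 / real k ^ 3"
  shows "summable t" and "suminf t \<le> (1 + q) / (1 - q)"
proof -
  have q: "0 < q" "q < 1" using k by (auto simp: q_def)
  have q_exp: "q ^ j = exp (real j * (- 3 * ln (real k)))" for j
  proof -
    have "exp (- 3 * ln (real k)) = q"
      using k exp_of_nat_mult[of 3 "ln (real k)"] by (simp add: q_def exp_minus inverse_eq_divide)
    then show ?thesis by (metis exp_of_nat_mult)
  qed
  have t_exp: "t a \<le> q ^ j"
    if pos: "1 + real j * h > 0" and a: "real a / real b = 1 + real j * h"
      and h: "real k * (ln (1 + h) - h) \<le> - 3 * ln (real k)" for a j h
  proof (cases "j = 0")
    case True
    then show ?thesis using a by (simp add: t_def)
  next
    case False
    have "t a = exp (real k * (ln (1 + real j * h) - real j * h))"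
      using pos unfolding t_def a by (simp add: exp_of_nat_mult exp_diff exp_minus divide_inverse)
    also have "\<dots> \<le> exp (real k * (real j * (ln (1 + h) - h)))"
      using ln_deviation_scale[of "real j" h] False pos by (simp add: mult_left_mono)
    also have "\<dots> = exp (real j * (real k * (ln (1 + h) - h)))" by (simp add: ac_simps)
    also have "\<dots> \<le> q ^ j"
      unfolding q_exp using h by (simp only: exp_le_cancel_iff mult_left_mono of_nat_0_le_iff)
    finally show ?thesis .
  qed
  let ?x = "1 / real b"
  have cubic: "real k * (- (?x ^ 2 / 2) + ?x ^ 3 / 3) \<le> - 3 * ln (real k)"
    using le by (simp add: field_simps power_divide)
  have upper: "t (i + b) \<le> q ^ i" for i
  proof (rule t_exp)
    have "real k * (ln (1 + ?x) - ?x) \<le> real k * (- (?x ^ 2 / 2) + ?x ^ 3 / 3)"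
      by (intro mult_left_mono ln_upper_cubic) auto
    then show "real k * (ln (1 + ?x) - ?x) \<le> - 3 * ln (real k)" using cubic by linarith
    show "real (i + b) / real b = 1 + real i * ?x" using b by (simp add: field_simps)
    show "1 + real i * ?x > 0" by (simp add: add_pos_nonneg)
  qed
  have lower: "t a \<le> q ^ (b - a)" if a: "a < b" for a
  proof (cases "a = 0")
    case True
    then show ?thesis using q k by (simp add: t_def power_0_left)
  next
    case False
    with a have "b > 1" by simp
    have "real k * (ln (1 - ?x) + ?x) \<le> real k * (- (?x ^ 2 / 2) + ?x ^ 3 / 3)"
      using \<open>b > 1\<close> by (intro mult_left_mono ln_upper_neg) auto
    then have "real k * (ln (1 + - ?x) - - ?x) \<le> - 3 * ln (real k)" using cubic by simp
    moreover have "real a / real b = 1 + real (b - a) * - ?x"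
      using a by (simp add: field_simps of_nat_diff)
    moreover from this have "1 + real (b - a) * - ?x > 0"
      using False b by (metis divide_pos_pos of_nat_0_less_iff neq0_conv)
    ultimately show ?thesis by (intro t_exp)
  qed
  have t_nonneg: "t a \<ge> 0" for a by (simp add: t_def)
  have geo: "summable (\<lambda>i. q ^ i)" "(\<Sum>i. q ^ i) = 1 / (1 - q)"
    using q by (auto simp: summable_geometric suminf_geometric)
  have sum_upper: "summable (\<lambda>i. t (i + b))"
    by (rule summable_comparison_test'[OF geo(1), of 0]) (use upper t_nonneg in auto)
  then show sum: "summable t" by (simp add: summable_iff_shift)
  have "(\<Sum>i. t (i + b)) \<le> 1 / (1 - q)"
    using suminf_le[OF upper sum_upper geo(1)] geo(2) by simp
  moreover have "(\<Sum>a<b. t a) \<le> q / (1 - q)"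
  proof -
    have "(\<Sum>a<b. t a) \<le> (\<Sum>a<b. q ^ (b - a))" by (intro sum_mono lower) simp
    also have "\<dots> = (\<Sum>i<b. q ^ Suc i)"
      by (subst sum.nat_diff_reindex[symmetric]) (simp add: Suc_diff_Suc)
    also have "\<dots> = q * (\<Sum>i<b. q ^ i)" by (simp add: sum_distrib_left)
    also have "\<dots> \<le> q * (1 / (1 - q))"
      using q sum_le_suminf[OF geo(1), of "{..<b}"] geo(2) by (intro mult_left_mono) auto
    finally show ?thesis by simp
  qed
  ultimately show "suminf t \<le> (1 + q) / (1 - q)"
    using suminf_split_initial_segment[OF sum, of b] by (simp add: add_divide_distrib)
qed

text \<open>For weight k + 1 the norm N_n contains n^k, and on this circle |z|^(2n) = exp(-nk/b).
  Both are k-th powers, so every summand is a constant times the k-th power of a single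
  profile.\<close>

lemma bergman_kernel_function_laplace:
  assumes k: "k \<ge> 1" and b: "b > 0" and z: "cmod z = exp (- (real k / (2 * real b)))"
    and sum: "summable (\<lambda>n. (real n / real b * exp (1 - real n / real b)) ^ k)"
  shows "bergman_kernel_function (k + 1) z =
    real k powr (3 / 2) / (real b * (2 * pi) powr (3 / 2)) *
      (sqrt (2 * pi) * (real k powr (real k + 1 / 2) * exp (- real k)) / fact k *
        (\<Sum>n. (real n / real b * exp (1 - real n / real b)) ^ k))"
proof -
  let ?t = "\<lambda>n. (real n / real b * exp (1 - real n / real b)) ^ k"
  have z_disk: "z \<in> punctured_disk" using z k b by (auto simp: punctured_disk_def)
  have L: "log_weight z = real k / real b"
  proof -
    have "exp (- log_weight z) = exp (- (real k / real b))"
      using exp_minus_log_weight[of z] z_disk z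
      by (simp add: punctured_disk_def exp_double[symmetric])
    then show ?thesis by simp
  qed
  \<comment> \<open>The factor common to all summands. Its exp(-k) pays for the factor e in the
    profile (n/b) exp(1 - n/b), which normalises the peak n = b to 1.\<close>
  define P where "P = real k ^ k / (real b * 2 * pi * fact (k - 1)) * real k * exp (- real k)"
  have summand: "log_weight z ^ (k + 1) * (cmod z ^ (2 * n) / monomial_norm2 (k + 1) n) = P * ?t n" for n
  proof -
    have e: "cmod z ^ (2 * n) = exp (- real k) * exp (1 - real n / real b) ^ k"
      using b by (simp add: z exp_of_nat_mult[symmetric] exp_add[symmetric] field_simps)
    have g: "(real k / real b) ^ (k + 1) * (X * E ^ k / (2 * pi * fact (k - 1) / real n ^ k)) =
        real k ^ k / (real b * 2 * pi * fact (k - 1)) * real k * X * (real n / real b * E) ^ k" for X E :: real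
      using b by (simp add: power_divide power_mult_distrib field_simps)
    have d: "k + 1 - 2 = k - 1" "k + 1 - 1 = k" by simp_all
    show ?thesis unfolding L e P_def monomial_norm2_def d by (rule g)
  qed
  have "summable (\<lambda>n. cmod z ^ (2 * n) / monomial_norm2 (k + 1) n)"
    using z_disk by (intro summable_kernel_series) (auto simp: punctured_disk_def)
  from suminf_mult[OF this, of "log_weight z ^ (k + 1)"]
  have "bergman_kernel_function (k + 1) z = (\<Sum>n. P * ?t n)"
    using k z_disk bergman_kernel_function_eq[of "k + 1" z] by (simp only: summand)
  also have "\<dots> = P * (\<Sum>n. ?t n)" by (rule suminf_mult[OF sum])
  also have "P = real k powr (3 / 2) / (real b * (2 * pi) powr (3 / 2)) *
      (sqrt (2 * pi) * (real k powr (real k + 1 / 2) * exp (- real k)) / fact k)"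
  proof -
    have f: "(fact k :: real) = real k * fact (k - 1)" using k by (simp add: fact_reduce)
    have "real k powr (3 / 2) * real k powr (real k + 1 / 2) = real k powr (real (k + 2))"
      by (simp add: powr_add[symmetric] add_ac)
    also have "\<dots> = real k ^ (k + 2)" using k by (subst powr_realpow) auto
    finally have p: "real k powr (3 / 2) * real k powr (real k + 1 / 2) = real k ^ (k + 2)" .
    have "(2 * pi) powr (1 + 1 / 2) = 2 * pi * sqrt (2 * pi)"
      unfolding powr_add by (simp add: powr_half_sqrt)
    then have s: "(2 * pi) powr (3 / 2) = 2 * pi * sqrt (2 * pi)" by simp
    have "real k powr (3 / 2) / (real b * (2 * pi) powr (3 / 2)) *
        (sqrt (2 * pi) * (real k powr (real k + 1 / 2) * exp (- real k)) / fact k) =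
        (real k powr (3 / 2) * real k powr (real k + 1 / 2)) * exp (- real k) / (real b * (2 * pi) * fact k)"
      unfolding s by simp
    also have "\<dots> = P" unfolding p f P_def using k by (simp add: power_add power2_eq_square ac_simps)
    finally show ?thesis by simp
  qed
  finally show ?thesis by (simp only: mult.assoc)
qed

theorem corollary1p1:
  fixes k b :: nat
  assumes "k \<ge> 79"
    and "b > 0"
    and "real k / (2 * real b ^ 2) - real k / (3 * real b ^ 3) \<ge> 3 * ln (real k)"
  shows "\<exists>\<epsilon>::real. \<epsilon> < 9 / real k ^ 2 \<and>
    (\<forall>z::complex. cmod z = exp (- (real k / (2 * real b))) \<longrightarrow>
       bergman_kernel_function (k + 1) z =
         real k powr (3 / 2) / (real b * (2 * pi) powr (3 / 2)) *
           (1 + 1 / (12 * real k) + \<epsilon>))"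
proof -
  define t where "t a = (real a / real b * exp (1 - real a / real b)) ^ k" for a :: nat
  define q where "q = 1 / real k ^ 3"
  have k: "k \<ge> 1" "k > 0" "k \<ge> 2" using assms by auto
  have t: "summable t" "suminf t \<le> (1 + q) / (1 - q)"
    using laplace_sum_bound[OF k(3) assms(2,3)] unfolding t_def[abs_def] q_def by auto
  have t_nonneg: "suminf t \<ge> 0" by (rule suminf_nonneg[OF t(1)]) (simp add: t_def)
  \<comment> \<open>Stirling's approximation of k! divided by k!.\<close>
  define R where "R = sqrt (2 * pi) * (real k powr (real k + 1 / 2) * exp (- real k)) / fact k"
  have R: "0 \<le> R" "R \<le> 1"
    using stirling_lower_bound[OF k(2)] by (auto simp: R_def divide_le_eq_1)
  have q: "0 < q" "q \<le> 1 / real k ^ 2" "q \<le> 1 / 2"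
  proof -
    show "0 < q" using k by (simp add: q_def)
    have "real k ^ 2 \<le> real k ^ 3" using k by (intro power_increasing) auto
    then show "q \<le> 1 / real k ^ 2" using k unfolding q_def by (intro divide_left_mono) auto
    have "(2::real) \<le> 2 ^ 3" by simp
    also have "\<dots> \<le> real k ^ 3" using k by (intro power_mono) auto
    finally show "q \<le> 1 / 2" using k unfolding q_def by (intro divide_left_mono) auto
  qed
  have "R * suminf t \<le> 1 * suminf t" using R t_nonneg by (intro mult_right_mono) auto
  also have "\<dots> \<le> (1 + q) / (1 - q)" using t by simp
  \<comment> \<open>After clearing the denominator this is 2q - 4q^2 >= 0, that is, q <=
    1/2.\<close>
  also have "\<dots> \<le> 1 + 4 * q"
  proof -
    have "0 \<le> q * (2 - 4 * q)" using q by simp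
    then have "1 + q \<le> (1 + 4 * q) * (1 - q)" by (simp add: algebra_simps)
    then show ?thesis using q by (simp add: pos_divide_le_eq)
  qed
  also have "\<dots> \<le> 1 + 9 / real k ^ 2" using q by simp
  also have "\<dots> < 1 + 1 / (12 * real k) + 9 / real k ^ 2" using k by simp
  \<comment> \<open>The left-hand side is the witness. It is built from \<open>k\<close> and
    \<open>b\<close> alone, so one value serves the whole circle; strictness comes from 1/(12k) >
    0.\<close>
  finally have "R * suminf t - 1 - 1 / (12 * real k) < 9 / real k ^ 2" by simp
  moreover have "bergman_kernel_function (k + 1) z = real k powr (3 / 2) / (real b * (2 * pi) powr (3 / 2)) *
      (1 + 1 / (12 * real k) + (R * suminf t - 1 - 1 / (12 * real k)))"
    if "cmod z = exp (- (real k / (2 * real b)))" for z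
    using bergman_kernel_function_laplace[OF k(1) assms(2) that t(1)[unfolded t_def[abs_def]]]
    unfolding R_def t_def[abs_def] by simp
  ultimately show ?thesis by blast
qed

end
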